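(* Let $r>1$ be irrational, $\Gamma_r=\{\exp(2\pi i n/r): n\in\mathbb{Z}\}\le\mathbb{C}^\times$, and let $\mathfrak G=(\Gamma_r,\cdot,{}^{-1},1,h(1),P_r)$, where $h(n)=\exp(2\pi i n/r)$ and $P_r=\big(h(-1),1\big)\cap\Gamma_r$ is the open counter-clockwise arc from $h(-1)$ to $1$ intersected with $\Gamma_r$. Let $n\ge1$ and $X\subseteq\Gamma_r^n$ be definable in $\mathfrak G$ but not definable in $(\Gamma_r,\cdot)$. Then $(\Gamma_r,\cdot,X)$ is interdefinable with $\mathfrak G$.
   Context: For $\alpha,\beta$ on the unit circle $\mathbb{S}$, $(\alpha,\beta)$ denotes the set of $\gamma\in\mathbb{S}$ strictly between $\alpha$ and $\beta$ when going counter-clockwise from $\alpha$ to $\beta$ (empty if $\alpha=\beta$). The map $h:\mathbb{Z}\to\Gamma_r$ is a group isomorphism, and $h$ maps $\{\lfloor nr\rfloor: n\in\mathbb{Z}\setminus\{0\}\}$ onto $P_r$. Definability allows parameters. *)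

theory Defs
  imports Complex_Main
begin

text \<open>First-order logic with equality. Symbols are drawn from types \<open>'f\<close> and \<open>'p\<close>; the arity maps are
  partial, and a symbol belongs to the language exactly if its arity is defined.\<close>

datatype 'f trm = Var nat | Fn 'f "'f trm list"

datatype ('f, 'p) fm =
    Eq "'f trm" "'f trm"
  | Rel 'p "'f trm list"
  | Neg "('f, 'p) fm"
  | Conj "('f, 'p) fm" "('f, 'p) fm"
  | Ex nat "('f, 'p) fm"

record ('f, 'p, 'a) fo_struct =
  univ :: "'a set"
  fn_arity :: "'f \<Rightarrow> nat option"
  fn_interp :: "'f \<Rightarrow> 'a list \<Rightarrow> 'a"
  rel_arity :: "'p \<Rightarrow> nat option"
  rel_interp :: "'p \<Rightarrow> 'a list set"

definition tuples :: "nat \<Rightarrow> 'a set \<Rightarrow> 'a list set" where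
  "tuples n A = {xs. length xs = n \<and> set xs \<subseteq> A}"

definition is_fo_struct :: "('f, 'p, 'a) fo_struct \<Rightarrow> bool" where
  "is_fo_struct M \<longleftrightarrow> univ M \<noteq> {} \<and>
     (\<forall>f k. fn_arity M f = Some k \<longrightarrow> fn_interp M f ` tuples k (univ M) \<subseteq> univ M) \<and>
     (\<forall>p k. rel_arity M p = Some k \<longrightarrow> rel_interp M p \<subseteq> tuples k (univ M))"

fun wf_trm :: "('f, 'p, 'a) fo_struct \<Rightarrow> 'f trm \<Rightarrow> bool" where
  "wf_trm M (Var i) \<longleftrightarrow> True"
| "wf_trm M (Fn f ts) \<longleftrightarrow> fn_arity M f = Some (length ts) \<and> (\<forall>t\<in>set ts. wf_trm M t)"

fun wf_fm :: "('f, 'p, 'a) fo_struct \<Rightarrow> ('f, 'p) fm \<Rightarrow> bool" where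
  "wf_fm M (Eq s t) \<longleftrightarrow> wf_trm M s \<and> wf_trm M t"
| "wf_fm M (Rel p ts) \<longleftrightarrow> rel_arity M p = Some (length ts) \<and> (\<forall>t\<in>set ts. wf_trm M t)"
| "wf_fm M (Neg \<phi>) \<longleftrightarrow> wf_fm M \<phi>"
| "wf_fm M (Conj \<phi> \<psi>) \<longleftrightarrow> wf_fm M \<phi> \<and> wf_fm M \<psi>"
| "wf_fm M (Ex i \<phi>) \<longleftrightarrow> wf_fm M \<phi>"

fun trm_val :: "('f, 'p, 'a) fo_struct \<Rightarrow> (nat \<Rightarrow> 'a) \<Rightarrow> 'f trm \<Rightarrow> 'a" where
  "trm_val M v (Var i) = v i"
| "trm_val M v (Fn f ts) = fn_interp M f (map (trm_val M v) ts)"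

fun sat :: "('f, 'p, 'a) fo_struct \<Rightarrow> (nat \<Rightarrow> 'a) \<Rightarrow> ('f, 'p) fm \<Rightarrow> bool" where
  "sat M v (Eq s t) \<longleftrightarrow> trm_val M v s = trm_val M v t"
| "sat M v (Rel p ts) \<longleftrightarrow> map (trm_val M v) ts \<in> rel_interp M p"
| "sat M v (Neg \<phi>) \<longleftrightarrow> \<not> sat M v \<phi>"
| "sat M v (Conj \<phi> \<psi>) \<longleftrightarrow> sat M v \<phi> \<and> sat M v \<psi>"
| "sat M v (Ex i \<phi>) \<longleftrightarrow> (\<exists>a\<in>univ M. sat M (v(i := a)) \<phi>)"

text \<open>Definability with parameters: the variables \<open>0, \<dots>, n - 1\<close> hold the tuple, and the
  remaining free variables of the formula are assigned parameters \<open>v i\<close> from the universe.\<close>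

definition definable :: "('f, 'p, 'a) fo_struct \<Rightarrow> nat \<Rightarrow> 'a list set \<Rightarrow> bool" where
  "definable M n X \<longleftrightarrow>
     (\<exists>\<phi> v. wf_fm M \<phi> \<and> (\<forall>i. v i \<in> univ M) \<and>
        X = {xs \<in> tuples n (univ M). sat M (\<lambda>i. if i < n then xs ! i else v i) \<phi>})"

definition interdefinable ::
    "('f, 'p, 'a) fo_struct \<Rightarrow> ('g, 'q, 'a) fo_struct \<Rightarrow> bool" where
  "interdefinable M N \<longleftrightarrow> univ M = univ N \<and> (\<forall>n X. definable M n X \<longleftrightarrow> definable N n X)"

text \<open>The open counter-clockwise arc from \<open>\<alpha>\<close> to \<open>\<beta>\<close>, for \<open>\<alpha>\<close>, \<open>\<beta>\<close> on the unit circle. It is empty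
  if \<open>\<alpha> = \<beta>\<close>, since then no \<open>t\<close> strictly between \<open>0\<close> and \<open>2 * pi\<close> exists.\<close>

definition ccw_arc :: "complex \<Rightarrow> complex \<Rightarrow> complex set" where
  "ccw_arc \<alpha> \<beta> = {\<gamma>. \<exists>s t. 0 < s \<and> s < t \<and> t < 2 * pi \<and> \<gamma> = \<alpha> * cis s \<and> \<beta> = \<alpha> * cis t}"

definition gam_exp :: "real \<Rightarrow> int \<Rightarrow> complex" where
  "gam_exp r n = exp (2 * of_real pi * \<i> * of_int n / of_real r)"

definition Gam :: "real \<Rightarrow> complex set" where
  "Gam r = range (gam_exp r)"

definition P_set :: "real \<Rightarrow> complex set" where
  "P_set r = ccw_arc (gam_exp r (-1)) 1 \<inter> Gam r"

datatype fn_sym = Mult | Inv | One | Gen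
datatype rel_sym = Pred

fun fn_std :: "real \<Rightarrow> fn_sym \<Rightarrow> complex list \<Rightarrow> complex" where
  "fn_std r Mult xs = xs ! 0 * xs ! 1"
| "fn_std r Inv xs = inverse (xs ! 0)"
| "fn_std r One xs = 1"
| "fn_std r Gen xs = gam_exp r 1"

definition G_struct :: "real \<Rightarrow> (fn_sym, rel_sym, complex) fo_struct" where
  "G_struct r = \<lparr>univ = Gam r,
     fn_arity = [Mult \<mapsto> 2, Inv \<mapsto> 1, One \<mapsto> 0, Gen \<mapsto> 0], fn_interp = fn_std r,
     rel_arity = [Pred \<mapsto> 1], rel_interp = (\<lambda>_. {[x] | x. x \<in> P_set r})\<rparr>"

definition Gam_struct :: "real \<Rightarrow> (fn_sym, rel_sym, complex) fo_struct" where
  "Gam_struct r = \<lparr>univ = Gam r,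
     fn_arity = [Mult \<mapsto> 2], fn_interp = fn_std r,
     rel_arity = Map.empty, rel_interp = (\<lambda>_. {})\<rparr>"

definition Gam_X_struct ::
    "real \<Rightarrow> nat \<Rightarrow> complex list set \<Rightarrow> (fn_sym, rel_sym, complex) fo_struct" where
  "Gam_X_struct r n X = \<lparr>univ = Gam r,
     fn_arity = [Mult \<mapsto> 2], fn_interp = fn_std r,
     rel_arity = [Pred \<mapsto> n], rel_interp = (\<lambda>_. X)\<rparr>"

lemma gam_exp_add: "gam_exp r (m + n) = gam_exp r m * gam_exp r n"
  by (simp add: gam_exp_def ring_distribs add_divide_distrib exp_add)

lemma gam_exp_minus: "gam_exp r (- n) = inverse (gam_exp r n)"
  by (simp add: gam_exp_def exp_minus)

lemma Gam_closed:
  "1 \<in> Gam r" "gam_exp r n \<in> Gam r"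
  "x \<in> Gam r \<Longrightarrow> y \<in> Gam r \<Longrightarrow> x * y \<in> Gam r"
  "x \<in> Gam r \<Longrightarrow> inverse x \<in> Gam r"
proof -
  show "1 \<in> Gam r" unfolding Gam_def by (rule range_eqI[of _ _ 0]) (simp add: gam_exp_def)
  show "gam_exp r n \<in> Gam r" by (simp add: Gam_def)
  show "x \<in> Gam r \<Longrightarrow> y \<in> Gam r \<Longrightarrow> x * y \<in> Gam r"
    by (auto simp: Gam_def simp flip: gam_exp_add)
  show "x \<in> Gam r \<Longrightarrow> inverse x \<in> Gam r"
    by (auto simp: Gam_def simp flip: gam_exp_minus)
qed

lemma fn_std_closed:
  assumes "[Mult \<mapsto> 2, Inv \<mapsto> 1, One \<mapsto> 0, Gen \<mapsto> 0] f = Some k" and "xs \<in> tuples k (Gam r)"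
  shows "fn_std r f xs \<in> Gam r"
proof -
  have "xs ! i \<in> Gam r" if "i < k" for i
    using assms(2) that by (auto simp: tuples_def)
  then show ?thesis
    using assms(1) by (cases f) (auto intro: Gam_closed)
qed

lemma fn_std_Mult_closed:
  assumes "[Mult \<mapsto> 2] f = Some k" and "xs \<in> tuples k (Gam r)"
  shows "fn_std r f xs \<in> Gam r"
  using assms by (intro fn_std_closed[of f k]) (auto split: if_splits)

lemma is_fo_struct_G: "is_fo_struct (G_struct r)"
proof -
  have "Gam r \<noteq> {}" using Gam_closed(1) by blast
  moreover have "{[x] | x. x \<in> P_set r} \<subseteq> tuples 1 (Gam r)"
    by (auto simp: tuples_def P_set_def)
  ultimately show ?thesis
    unfolding is_fo_struct_def G_struct_def fo_struct.simps
    using fn_std_closed by (auto split: if_splits simp del: fun_upd_apply) (auto split: if_splits)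
qed

lemma is_fo_struct_Gam: "is_fo_struct (Gam_struct r)"
proof -
  have "Gam r \<noteq> {}" using Gam_closed(1) by blast
  then show ?thesis
    unfolding is_fo_struct_def Gam_struct_def fo_struct.simps
    using fn_std_Mult_closed by (auto simp del: fun_upd_apply)
qed

lemma is_fo_struct_Gam_X:
  assumes "X \<subseteq> tuples n (Gam r)"
  shows "is_fo_struct (Gam_X_struct r n X)"
proof -
  have "Gam r \<noteq> {}" using Gam_closed(1) by blast
  moreover have "X \<subseteq> tuples k (Gam r)" if "[Pred \<mapsto> n] p = Some k" for p k
    using assms that by (simp split: if_splits)
  ultimately show ?thesis
    unfolding is_fo_struct_def Gam_X_struct_def fo_struct.simps
    using fn_std_Mult_closed by (auto simp del: fun_upd_apply)
qed

end

theory Submission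
  imports Defs "HOL-Analysis.Kronecker_Approximation_Theorem"
begin

text \<open>Transport everything to \<open>\<int>\<close> along \<open>h\<close> and put \<open>\<theta> = 1 / r\<close>. The map \<open>n \<mapsto> n\<theta> - \<lfloor>n\<theta>\<rfloor>\<close> identifies \<open>\<int>\<close> with
  \<open>A \<inter> [0, 1)\<close> for the dense subgroup \<open>A = \<int> + \<int>\<theta>\<close> of \<open>\<real>\<close>, and a back-and-forth argument shows that a set
  definable in \<open>\<GG>\<close> depends only on congruences in \<open>A\<close> and on the signs of finitely many affine forms. Congruences
  have to be taken in \<open>A\<close>, not in \<open>\<int>\<close>: halving an even \<open>n\<close> halves its angle only up to the parity of \<open>\<lfloor>n\<theta>\<rfloor>\<close>.

  Hence a definable unary set is, on each congruence class, a finite union of arcs up to finitely many points. If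
  such a union is neither empty nor everything, let \<open>p\<close> be a boundary point. Agreement with finitely many translates
  cuts out a small neighbourhood of the finite group \<open>H\<close> of its periods, and near \<open>H\<close> the inclusion between
  translates at \<open>p\<close> defines the order, hence short closed arcs modulo \<open>H\<close>. Multiplication by \<open>|H|\<close> and a
  finite union of translates remove \<open>H\<close> and yield \<open>P\<^sub>r\<close>.

  If \<open>P\<^sub>r\<close> is not definable in \<open>(\<Gamma>\<^sub>r, X)\<close>, then all its unary sets are trivial in this sense. Applied to the
  fibres over the last variable, this writes a definable set as a combination of congruences, of finitely many linear
  equations, and of definable sets in one variable less, so by induction it is definable in the group alone.\<close>

section \<open>Definability over the integers\<close>

text \<open>A syntax-free account of definability with parameters: relations live on assignments of
  all variables, \<open>const\<close> supplies the parameters and \<open>rename\<close> takes care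
  of variable names. The group is written additively, through exponents.\<close>

inductive_set dfn :: "((nat \<Rightarrow> int) \<Rightarrow> bool) set \<Rightarrow> ((nat \<Rightarrow> int) \<Rightarrow> bool) set"
  for B where
  base: "R \<in> B \<Longrightarrow> R \<in> dfn B"
| add: "(\<lambda>w. w i + w j = w k) \<in> dfn B"
| const: "(\<lambda>w. w i = c) \<in> dfn B"
| neg: "R \<in> dfn B \<Longrightarrow> (\<lambda>w. \<not> R w) \<in> dfn B"
| conj: "R \<in> dfn B \<Longrightarrow> S \<in> dfn B \<Longrightarrow> (\<lambda>w. R w \<and> S w) \<in> dfn B"
| ex: "R \<in> dfn B \<Longrightarrow> (\<lambda>w. \<exists>a. R (w(i := a))) \<in> dfn B"
| rename: "R \<in> dfn B \<Longrightarrow> (\<lambda>w. R (\<lambda>i. w (\<rho> i))) \<in> dfn B"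

text \<open>Applied in both directions, this turns mutual definability of two families of generators
  into equality of the definable relations.\<close>

lemma dfn_cut:
  assumes "B \<subseteq> dfn C"
  shows "dfn B \<subseteq> dfn C"
proof
  show "R \<in> dfn C" if "R \<in> dfn B" for R
    using that
  proof induction
    case (base R)
    then show ?case using assms by blast
  qed (rule dfn.intros; assumption)+
qed

definition supported :: "nat \<Rightarrow> ((nat \<Rightarrow> int) \<Rightarrow> bool) \<Rightarrow> bool" where
  "supported K R \<longleftrightarrow> (\<forall>w w'. (\<forall>i<K. w i = w' i) \<longrightarrow> R w = R w')"

lemma supportedD: "supported K R \<Longrightarrow> (\<And>i. i < K \<Longrightarrow> w i = w' i) \<Longrightarrow> R w = R w'"
  unfolding supported_def by blast

lemma supported_mono: "supported K R \<Longrightarrow> K \<le> L \<Longrightarrow> supported L R"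
  unfolding supported_def by (meson order_less_le_trans)

text \<open>Assignments have infinitely many coordinates; finite support is what allows all
  variables to be substituted at once in \<open>dfn_subst\<close>.\<close>

lemma dfn_supported:
  assumes "R \<in> dfn B" and "\<And>R. R \<in> B \<Longrightarrow> \<exists>K. supported K R"
  shows "\<exists>K. supported K R"
  using assms(1)
proof induction
  case (base R)
  then show ?case by (rule assms(2))
next
  case (add i j k)
  have "supported (Suc (i + j + k)) (\<lambda>w. w i + w j = w k)"
    by (auto simp: supported_def)
  then show ?case ..
next
  case (const i c)
  have "supported (Suc i) (\<lambda>w. w i = c)"
    by (auto simp: supported_def)
  then show ?case ..
next
  case (neg R)
  then show ?case unfolding supported_def by blast
next
  case (conj R S)
  then obtain K L where "supported K R" "supported L S" by blast
  then have "supported (max K L) R" "supported (max K L) S"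
    by (auto intro: supported_mono)
  then have "supported (max K L) (\<lambda>w. R w \<and> S w)"
    unfolding supported_def by blast
  then show ?case ..
next
  case (ex R i)
  then obtain K where K: "supported K R" by blast
  have "supported K (\<lambda>w. \<exists>a. R (w(i := a)))"
    unfolding supported_def
  proof (intro allI impI)
    fix w w' :: "nat \<Rightarrow> int" assume "\<forall>i<K. w i = w' i"
    then have "R (w(i := a)) = R (w'(i := a))" for a
      by (intro supportedD[OF K]) auto
    then show "(\<exists>a. R (w(i := a))) = (\<exists>a. R (w'(i := a)))" by simp
  qed
  then show ?case ..
next
  case (rename R \<rho>)
  then obtain K where K: "supported K R" by blast
  \<comment> \<open>The sum is a crude upper bound for all indices \<open>\<rho> i\<close> with
    \<open>i < K\<close>.\<close>
  have "supported (Suc (\<Sum>i<K. \<rho> i)) (\<lambda>w. R (\<lambda>i. w (\<rho> i)))"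
    unfolding supported_def
  proof (intro allI impI supportedD[OF K])
    fix w w' :: "nat \<Rightarrow> int" and i
    assume w: "\<forall>i<Suc (\<Sum>i<K. \<rho> i). w i = w' i" and i: "i < K"
    have "\<rho> i \<le> (\<Sum>i<K. \<rho> i)"
      using i by (intro member_le_sum) auto
    then show "w (\<rho> i) = w' (\<rho> i)" using w by simp
  qed
  then show ?case ..
qed

lemma dfn_disj:
  assumes "R \<in> dfn B" "S \<in> dfn B"
  shows "(\<lambda>w. R w \<or> S w) \<in> dfn B"
proof -
  have "(\<lambda>w. \<not> (\<not> R w \<and> \<not> S w)) \<in> dfn B"
    by (intro neg conj assms)
  then show ?thesis by simp
qed

lemma dfn_imp:
  assumes "R \<in> dfn B" "S \<in> dfn B"
  shows "(\<lambda>w. R w \<longrightarrow> S w) \<in> dfn B"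
proof -
  have "(\<lambda>w. \<not> R w \<or> S w) \<in> dfn B"
    by (intro neg dfn_disj assms)
  then show ?thesis by simp
qed

lemma dfn_triv: "(\<lambda>w. b) \<in> dfn B"
proof -
  have t: "(\<lambda>w. True) \<in> dfn B"
  proof -
    have "(\<lambda>w. w 0 = 0 \<longrightarrow> w 0 = 0) \<in> dfn B" by (intro dfn_imp const)
    then show ?thesis by simp
  qed
  then show ?thesis using neg[OF t] by (cases b) auto
qed

lemma dfn_iff_triv: "R \<in> dfn B \<Longrightarrow> (\<lambda>w. R w = b) \<in> dfn B"
  by (cases b) (simp_all add: neg)

lemma dfn_all:
  assumes "R \<in> dfn B"
  shows "(\<lambda>w. \<forall>a. R (w(i := a))) \<in> dfn B"
proof -
  have "(\<lambda>w. \<not> (\<exists>a. \<not> R (w(i := a)))) \<in> dfn B"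
    by (intro neg ex[OF neg] assms)
  then show ?thesis by simp
qed

lemma dfn_Ball: "finite A \<Longrightarrow> (\<And>a. a \<in> A \<Longrightarrow> R a \<in> dfn B) \<Longrightarrow> (\<lambda>w. \<forall>a\<in>A. R a w) \<in> dfn B"
  by (induction A rule: finite_induct) (simp_all add: dfn_triv conj)

lemma dfn_Bex: "finite A \<Longrightarrow> (\<And>a. a \<in> A \<Longrightarrow> R a \<in> dfn B) \<Longrightarrow> (\<lambda>w. \<exists>a\<in>A. R a w) \<in> dfn B"
  by (induction A rule: finite_induct) (simp_all add: dfn_triv dfn_disj)

section \<open>Substitution of affine forms\<close>

text \<open>Quantifies over a new coordinate pushed in front, in the style of de Bruijn indices, so
  that no fresh variable has to be named. The truncated difference \<open>0 - 1\<close> does no harm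
  because coordinate 0 is overwritten.\<close>

lemma dfn_ex_push:
  assumes "R \<in> dfn B"
  shows "(\<lambda>w. \<exists>a. R (case_nat a w)) \<in> dfn B"
proof -
  have "(\<lambda>i. w (i - 1))(0 := a) = case_nat a w" for w :: "nat \<Rightarrow> int" and a
    by (auto split: nat.split)
  then show ?thesis
    using rename[OF ex[OF assms, of 0], of "\<lambda>i. i - 1"] by simp
qed

text \<open>\<open>lin f g\<close>: \<open>g\<close> is an affine form over the integers, and \<open>f\<close> is a form in real variables with the
  same linear part and an unrelated constant.\<close>

inductive lin :: "((nat \<Rightarrow> real) \<Rightarrow> real) \<Rightarrow> ((nat \<Rightarrow> int) \<Rightarrow> int) \<Rightarrow> bool" where
  lin_const: "lin (\<lambda>x. c) (\<lambda>w. d)"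
| lin_var: "lin (\<lambda>x. x i) (\<lambda>w. w i)"
| lin_diff: "lin f g \<Longrightarrow> lin f' g' \<Longrightarrow> lin (\<lambda>x. f x - f' x) (\<lambda>w. g w - g' w)"

lemma lin_add: "lin f g \<Longrightarrow> lin f' g' \<Longrightarrow> lin (\<lambda>x. f x + f' x) (\<lambda>w. g w + g' w)"
  using lin_diff[OF _ lin_diff[OF lin_const[of 0 0]], of f g f' g'] by simp

lemma lin_scale:
  assumes "lin f g"
  shows "lin (\<lambda>x. of_int k * f x) (\<lambda>w. k * g w)"
proof (induction k rule: int_induct[of _ 0])
  case base
  then show ?case using lin_const[of 0 0] by simp
next
  case (step1 i)
  then show ?case using lin_add[OF step1(2) assms] by (simp add: algebra_simps)
next
  case (step2 i)
  then show ?case using lin_diff[OF step2(2) assms] by (simp add: algebra_simps)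
qed

lemma lin_rename: "lin f g \<Longrightarrow> lin (\<lambda>x. f (\<lambda>i. x (\<rho> i))) (\<lambda>w. g (\<lambda>i. w (\<rho> i)))"
  by (induction rule: lin.induct) (auto intro: lin.intros)

text \<open>Prepares for eliminating one variable: both forms have the same coefficient
  \<open>k\<close> there, and invariance under updates says that the remainders do not involve
  it.\<close>

lemma lin_split:
  "lin f g \<Longrightarrow> \<exists>k f0 g0. lin f0 g0 \<and> (\<forall>x. f x = of_int k * x i + f0 x) \<and> (\<forall>w. g w = k * w i + g0 w)
     \<and> (\<forall>x a. f0 (x(i := a)) = f0 x) \<and> (\<forall>w a. g0 (w(i := a)) = g0 w)"
proof (induction rule: lin.induct)
  case (lin_const c d)
  show ?case
    by (rule exI[of _ 0], rule exI[of _ "\<lambda>x. c"], rule exI[of _ "\<lambda>w. d"]) (auto intro: lin.intros)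
next
  case (lin_var j)
  show ?case
  proof (cases "j = i")
    case True
    show ?thesis
      by (rule exI[of _ 1], rule exI[of _ "\<lambda>x. 0"], rule exI[of _ "\<lambda>w. 0"])
        (auto simp: True intro: lin.intros)
  next
    case False
    then show ?thesis
      by (intro exI[of _ 0] exI[of _ "\<lambda>x. x j"] exI[of _ "\<lambda>w. w j"]) (auto intro: lin.intros)
  qed
next
  case (lin_diff f g f' g')
  then obtain k f0 g0 k' f0' g0' where
    "lin f0 g0 \<and> (\<forall>x. f x = of_int k * x i + f0 x) \<and> (\<forall>w. g w = k * w i + g0 w)
     \<and> (\<forall>x a. f0 (x(i := a)) = f0 x) \<and> (\<forall>w a. g0 (w(i := a)) = g0 w)"
    "lin f0' g0' \<and> (\<forall>x. f' x = of_int k' * x i + f0' x) \<and> (\<forall>w. g' w = k' * w i + g0' w)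
     \<and> (\<forall>x a. f0' (x(i := a)) = f0' x) \<and> (\<forall>w a. g0' (w(i := a)) = g0' w)" by blast
  then show ?case
    by (intro exI[of _ "k - k'"] exI[of _ "\<lambda>x. f0 x - f0' x"] exI[of _ "\<lambda>w. g0 w - g0' w"])
      (auto intro: lin.intros simp: algebra_simps simp del: fun_upd_apply)
qed

definition aff :: "((nat \<Rightarrow> int) \<Rightarrow> int) \<Rightarrow> bool" where
  "aff g \<longleftrightarrow> (\<exists>f. lin f g)"

lemma aff_const: "aff (\<lambda>w. c)"
  and aff_var: "aff (\<lambda>w. w i)"
  and aff_diff: "aff g \<Longrightarrow> aff h \<Longrightarrow> aff (\<lambda>w. g w - h w)"
  and aff_add: "aff g \<Longrightarrow> aff h \<Longrightarrow> aff (\<lambda>w. g w + h w)"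
  and aff_uminus: "aff g \<Longrightarrow> aff (\<lambda>w. - g w)"
  and aff_scale: "aff g \<Longrightarrow> aff (\<lambda>w. c * g w)"
  and aff_rename: "aff g \<Longrightarrow> aff (\<lambda>w. g (\<lambda>i. w (\<rho> i)))"
  unfolding aff_def
  by (blast intro: lin.intros lin_add lin_rename lin_scale lin_scale[of _ _ "-1", simplified])+

lemmas aff_intros = aff_const aff_var aff_diff aff_add aff_uminus aff_scale

text \<open>The renaming makes the induction go through: the two intermediate values for a
  difference are pushed in front and shift every other variable by two.\<close>

lemma dfn_aff_rename: "lin f g \<Longrightarrow> (\<lambda>w. w i = g (\<lambda>i. w (\<rho> i))) \<in> dfn B"
proof (induction arbitrary: i \<rho> rule: lin.induct)
  case (lin_const c d)
  show ?case by (rule const)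
next
  case (lin_var j)
  \<comment> \<open>Equality of two variables is written as an addition of zero, since
    \<open>add\<close> and \<open>const\<close> are the only atoms available for arbitrary
    \<open>B\<close>.\<close>
  have "(\<lambda>w. \<exists>a. case_nat a w 0 = 0 \<and> case_nat a w (Suc i) + case_nat a w 0 = case_nat a w (Suc (\<rho> j)))
      \<in> dfn B"
    by (intro dfn_ex_push conj const add)
  then show ?case by simp
next
  case (lin_diff f g f' g')
  have "(\<lambda>w. w 0 = g (\<lambda>i. w (Suc (Suc (\<rho> i))))) \<in> dfn B" (is "?P \<in> _")
    "(\<lambda>w. w 1 = g' (\<lambda>i. w (Suc (Suc (\<rho> i))))) \<in> dfn B" (is "?Q \<in> _")
    by (rule lin_diff.IH)+
  then have "(\<lambda>w. \<exists>a b. (\<lambda>w. ?P w \<and> ?Q w \<and> w (Suc (Suc i)) + w 1 = w 0) (case_nat b (case_nat a w)))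
       \<in> dfn B"
    by (intro dfn_ex_push[of "\<lambda>w. \<exists>b. ?P (case_nat b w) \<and> ?Q (case_nat b w) \<and> 
          case_nat b w (Suc (Suc i)) + case_nat b w 1 = case_nat b w 0"] 
        dfn_ex_push conj add)
  moreover have "(x + b = a) = (x = a - b)" for x a b :: int by auto
  ultimately show ?case by simp
qed

lemma dfn_push:
  assumes R: "R \<in> dfn B" and g: "aff g"
  shows "(\<lambda>w. R (case_nat (g w) w)) \<in> dfn B"
proof -
  obtain f where f: "lin f g" using g unfolding aff_def by blast
  have "(\<lambda>w. \<exists>a. (\<lambda>w. w 0 = g (\<lambda>i. w (Suc i)) \<and> R w) (case_nat a w)) \<in> dfn B"
    by (intro dfn_ex_push conj R dfn_aff_rename[OF f])
  then show ?thesis by simp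
qed

lemma dfn_push_tuple:
  assumes "R \<in> dfn B" and "\<And>i. aff (g i)"
  shows "(\<lambda>w. R (\<lambda>i. if i < n then g i w else w (i - n))) \<in> dfn B"
  using assms
proof (induction n arbitrary: g R)
  case 0
  then show ?case by simp
next
  case (Suc n)
  \<comment> \<open>\<open>g 0\<close> has to read the original variables, which sit
    \<open>n\<close> places further back once the other \<open>n\<close> values are in
    front.\<close>
  have "(\<lambda>w. R (case_nat (g 0 (\<lambda>i. w (i + n))) w)) \<in> dfn B"
    by (rule dfn_push[OF Suc.prems(1) aff_rename[OF Suc.prems(2)]])
  from Suc.IH[OF this, of "\<lambda>i. g (Suc i)"] Suc.prems(2)
  have "(\<lambda>w. R (case_nat (g 0 w) (\<lambda>i. if i < n then g (Suc i) w else w (i - n)))) \<in> dfn B"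
    by simp
  moreover have "case_nat (g 0 w) (\<lambda>i. if i < n then g (Suc i) w else w (i - n))
      = (\<lambda>i. if i < Suc n then g i w else w (i - Suc n))" for w
    by (auto split: nat.split)
  ultimately show ?case by simp
qed

lemma dfn_subst:
  assumes "R \<in> dfn B" and "supported K R" and "\<And>i. aff (g i)"
  shows "(\<lambda>w. R (\<lambda>i. g i w)) \<in> dfn B"
proof -
  have "R (\<lambda>i. g i w) = R (\<lambda>i. if i < K then g i w else w (i - K))" for w
    by (rule supportedD[OF assms(2)]) auto
  then show ?thesis using dfn_push_tuple[OF assms(1,3), of K] by simp
qed

lemma dfn_subst_unary:
  assumes "(\<lambda>w. Q (w 0)) \<in> dfn B" and "aff g"
  shows "(\<lambda>w. Q (g w)) \<in> dfn B"
  using dfn_push[OF assms] by simp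

lemma dfn_eq:
  assumes "aff g" "aff h"
  shows "(\<lambda>w. g w = h w) \<in> dfn B"
proof -
  have "(\<lambda>w. g w - h w = 0) \<in> dfn B"
    by (rule dfn_subst_unary[where Q = "\<lambda>a. a = 0"]) (rule const aff_diff assms)+
  then show ?thesis by simp
qed

text \<open>Quantifying over the quotient makes congruence classes definable in the bare
  group.\<close>

lemma dfn_cong_mod: 
  assumes "aff g"
  shows "(\<lambda>w. g w mod m = c mod (m::int)) \<in> dfn B"
proof -
  let ?Q = "\<lambda>w. g (\<lambda>i. w (Suc i)) = c + m * w 0"
  have "?Q \<in> dfn B"
    by (rule dfn_eq[OF aff_rename[OF assms] aff_add[OF aff_const aff_scale[OF aff_var]]])
  then have "(\<lambda>w. \<exists>a. ?Q (case_nat a w)) \<in> dfn B"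
    by (rule dfn_ex_push)
  moreover have "(\<exists>a. g w = c + m * a) = (g w mod m = c mod m)" for w
    by (auto simp: mod_eq_dvd_iff dvd_def algebra_simps)
  ultimately show ?thesis by simp
qed

section \<open>Formulas\<close>

fun trm_vars :: "'f trm \<Rightarrow> nat set" where
  "trm_vars (Var i) = {i}"
| "trm_vars (Fn f ts) = (\<Union>t\<in>set ts. trm_vars t)"

text \<open>Bound variables are kept: an upper bound for the free variables suffices to choose fresh
  names.\<close>

fun fm_vars :: "('f, 'p) fm \<Rightarrow> nat set" where
  "fm_vars (Eq s t) = trm_vars s \<union> trm_vars t"
| "fm_vars (Rel p ts) = (\<Union>t\<in>set ts. trm_vars t)"
| "fm_vars (Neg \<phi>) = fm_vars \<phi>"
| "fm_vars (Conj \<phi> \<psi>) = fm_vars \<phi> \<union> fm_vars \<psi>"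
| "fm_vars (Ex i \<phi>) = fm_vars \<phi>"

lemma finite_trm_vars: "finite (trm_vars t)"
  by (induction t) auto

lemma finite_fm_vars: "finite (fm_vars \<phi>)"
  by (induction \<phi>) (auto simp: finite_trm_vars)

fun trm_rename :: "(nat \<Rightarrow> nat) \<Rightarrow> 'f trm \<Rightarrow> 'f trm" where
  "trm_rename \<rho> (Var i) = Var (\<rho> i)"
| "trm_rename \<rho> (Fn f ts) = Fn f (map (trm_rename \<rho>) ts)"

text \<open>Capture is avoided because the new bound variable \<open>k\<close> exceeds
  \<open>\<rho> j\<close> for every \<open>j\<close> in \<open>fm_vars\<close> of the body, each of
  these being at most the sum.\<close>

fun fm_rename :: "(nat \<Rightarrow> nat) \<Rightarrow> ('f, 'p) fm \<Rightarrow> ('f, 'p) fm" where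
  "fm_rename \<rho> (Eq s t) = Eq (trm_rename \<rho> s) (trm_rename \<rho> t)"
| "fm_rename \<rho> (Rel p ts) = Rel p (map (trm_rename \<rho>) ts)"
| "fm_rename \<rho> (Neg \<phi>) = Neg (fm_rename \<rho> \<phi>)"
| "fm_rename \<rho> (Conj \<phi> \<psi>) = Conj (fm_rename \<rho> \<phi>) (fm_rename \<rho> \<psi>)"
| "fm_rename \<rho> (Ex i \<phi>) =
     (let k = Suc (sum \<rho> (fm_vars \<phi>)) in Ex k (fm_rename (\<rho>(i := k)) \<phi>))"

lemma wf_trm_rename: "wf_trm M (trm_rename \<rho> t) = wf_trm M t"
  by (induction t) auto

lemma wf_fm_rename: "wf_fm M (fm_rename \<rho> \<phi>) = wf_fm M \<phi>"
  by (induction \<phi> arbitrary: \<rho>) (auto simp: wf_trm_rename Let_def)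

lemma trm_val_rename:
  "(\<And>i. i \<in> trm_vars t \<Longrightarrow> v' i = v (\<rho> i)) \<Longrightarrow> trm_val M v (trm_rename \<rho> t) = trm_val M v' t"
proof (induction t)
  case (Fn f ts)
  then have "map (trm_val M v) (map (trm_rename \<rho>) ts) = map (trm_val M v') ts"
    by auto
  then show ?case by (simp only: trm_rename.simps trm_val.simps)
qed auto

lemma sat_rename:
  "(\<And>i. i \<in> fm_vars \<phi> \<Longrightarrow> v' i = v (\<rho> i)) \<Longrightarrow> sat M v (fm_rename \<rho> \<phi>) = sat M v' \<phi>"
proof (induction \<phi> arbitrary: \<rho> v v')
  case (Eq s t)
  then have "trm_val M v (trm_rename \<rho> s) = trm_val M v' s"
    "trm_val M v (trm_rename \<rho> t) = trm_val M v' t"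
    by (auto intro!: trm_val_rename)
  then show ?case by simp
next
  case (Rel p ts)
  then have "map (trm_val M v) (map (trm_rename \<rho>) ts) = map (trm_val M v') ts"
    by (auto intro!: trm_val_rename)
  then show ?case by (simp only: fm_rename.simps sat.simps)
next
  case (Ex i \<phi>)
  define k where "k = Suc (sum \<rho> (fm_vars \<phi>))"
  have "sat M (v(k := a)) (fm_rename (\<rho>(i := k)) \<phi>) = sat M (v'(i := a)) \<phi>" for a
  proof (rule Ex.IH)
    fix j assume j: "j \<in> fm_vars \<phi>"
    then have "\<rho> j < k"
      unfolding k_def by (simp add: less_Suc_eq_le member_le_sum finite_fm_vars)
    then show "(v'(i := a)) j = (v(k := a)) ((\<rho>(i := k)) j)"
      using Ex.prems[of j] j by auto
  qed
  then show ?case by (simp add: Let_def flip: k_def)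
next
  case (Conj \<phi> \<psi>)
  have "sat M v (fm_rename \<rho> \<phi>) = sat M v' \<phi>" "sat M v (fm_rename \<rho> \<psi>) = sat M v' \<psi>"
    by (rule Conj.IH, rule Conj.prems, simp)+
  then show ?case by simp
next
  case (Neg \<phi>)
  have "sat M v (fm_rename \<rho> \<phi>) = sat M v' \<phi>"
    by (rule Neg.IH, rule Neg.prems, simp)
  then show ?case by simp
qed

section \<open>Angles and the arc in integer coordinates\<close>

lemma gam_exp_cis: "gam_exp r n = cis (2 * pi * of_int n / r)"
  unfolding gam_exp_def cis_conv_exp by (simp add: mult_ac)

lemma cis_eq_cis_iff: "cis x = cis y \<longleftrightarrow> (\<exists>k::int. x = y + 2 * pi * k)"
proof
  assume "cis x = cis y"
  then have "cis (x - y) = 1" by (metis cis_divide div_self cis_neq_zero)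
  then have "cos (x - y) = 1" by (metis Re_complex_of_real cis.sel(1) of_real_1)
  then obtain k :: int where "x - y = k * 2 * pi" by (auto simp: cos_one_2pi_int)
  then have "x = y + 2 * pi * k" by (simp add: algebra_simps)
  then show "\<exists>k::int. x = y + 2 * pi * k" ..
next
  assume "\<exists>k::int. x = y + 2 * pi * k"
  then obtain k :: int where k: "x = y + 2 * pi * k" ..
  have "cis (2 * pi * k) = 1" by (rule cis_multiple_2pi) simp
  then show "cis x = cis y" by (simp add: k flip: cis_mult)
qed

locale beatty =
  fixes r :: real
  assumes r1: "r > 1" and irr: "r \<notin> \<rat>"
begin

definition \<theta> :: real where "\<theta> = 1 / r"

lemma theta: "0 < \<theta>" "\<theta> < 1" "\<theta> \<notin> \<rat>"
proof -
  show "0 < \<theta>" "\<theta> < 1" using r1 by (auto simp: \<theta>_def)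
  show "\<theta> \<notin> \<rat>" using irr Rats_divide[OF Rats_1, of \<theta>] by (auto simp: \<theta>_def)
qed

text \<open>Besides density of the rotation, this is how irrationality of \<theta> is used: a
  representation in Z + Z \<theta> is unique.\<close>

lemma int_theta_eq:
  assumes "of_int a * \<theta> = of_int b"
  shows "a = 0"
proof (rule ccontr)
  assume "a \<noteq> 0"
  then have "\<theta> = of_int b / of_int a" using assms by (simp add: field_simps)
  then show False using theta(3) by auto
qed

abbreviation h :: "int \<Rightarrow> complex" where "h \<equiv> gam_exp r"

lemma h_inj: "h a = h b \<longleftrightarrow> a = b"
proof
  assume "h a = h b"
  then obtain k :: int where "2 * pi * of_int a / r = 2 * pi * of_int b / r + 2 * pi * k"
    by (auto simp: gam_exp_cis cis_eq_cis_iff)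
  then have "2 * pi * (of_int (a - b) * \<theta>) = 2 * pi * of_int k"
    by (simp add: \<theta>_def algebra_simps diff_divide_distrib)
  then have "of_int (a - b) * \<theta> = of_int k" by simp
  then show "a = b" using int_theta_eq[of "a - b" k] by simp
qed simp

text \<open>In units of full turns the arc runs from -\<theta> to 0, since \<open>h (-1)\<close> has
  angle -\<theta> and 0 < \<theta> < 1.\<close>

lemma P_set_iff: "h z \<in> P_set r \<longleftrightarrow> (\<exists>k::int. - \<theta> < of_int z * \<theta> - of_int k \<and> of_int z * \<theta> - of_int k < 0)"
proof -
  have h: "h n = cis (2 * pi * (of_int n * \<theta>))" for n by (simp add: gam_exp_cis \<theta>_def)
  have "h z \<in> P_set r \<longleftrightarrow> (\<exists>s t. 0 < s \<and> s < t \<and> t < 2 * pi \<and> h z = h (-1) * cis s \<and> cis 0 = h (-1) * cis t)"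
    by (simp add: P_set_def ccw_arc_def Gam_def)
  also have "\<dots> \<longleftrightarrow> (\<exists>s t. 0 < s \<and> s < t \<and> t < 2 * pi \<and>
      (\<exists>k::int. 2 * pi * (of_int z * \<theta>) = 2 * pi * (- \<theta>) + s + 2 * pi * k) \<and>
      (\<exists>k::int. 0 = 2 * pi * (- \<theta>) + t + 2 * pi * k))"
    by (simp only: h cis_mult cis_eq_cis_iff) simp
  also have "\<dots> \<longleftrightarrow> (\<exists>k::int. - \<theta> < of_int z * \<theta> - of_int k \<and> of_int z * \<theta> - of_int k < 0)" (is "?L \<longleftrightarrow> ?R")
  proof
    assume ?L
    then obtain s t and k l :: int where st: "0 < s" "s < t" "t < 2 * pi"
      and k: "2 * pi * (of_int z * \<theta>) = 2 * pi * (- \<theta>) + s + 2 * pi * k"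
      and l: "0 = 2 * pi * (- \<theta>) + t + 2 * pi * l" by blast
    define s' t' where "s' = s / (2 * pi)" and "t' = t / (2 * pi)"
    have "2 * pi * (of_int z * \<theta>) = 2 * pi * (- \<theta> + s' + k)"
      unfolding ring_distribs using k by (simp add: s'_def)
    then have k': "of_int z * \<theta> = - \<theta> + s' + k" by simp
    have "t = 2 * pi * (\<theta> - l)" using l by (simp add: algebra_simps)
    then have l': "t' = \<theta> - l" by (simp add: t'_def)
    have "0 < s'" "s' < t'" "t' < 1" using st by (auto simp: s'_def t'_def divide_strict_right_mono)
    \<comment> \<open>The endpoint determines the length of the arc: \<theta> is the only number in
      (0, 1) congruent to \<theta> modulo 1.\<close>
    moreover from this l' have "l = 0" using theta by linarith
    ultimately show ?R using k' l' by (intro exI[of _ k]) auto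
  next
    assume ?R
    then obtain k :: int where k: "- \<theta> < of_int z * \<theta> - of_int k" "of_int z * \<theta> - of_int k < 0" by blast
    show ?L
    proof (rule exI[of _ "2 * pi * (of_int z * \<theta> - of_int k + \<theta>)"],
        rule exI[of _ "2 * pi * \<theta>"], intro conjI)
      show "0 < 2 * pi * (of_int z * \<theta> - of_int k + \<theta>)" using k(1) by simp
      show "2 * pi * (of_int z * \<theta> - of_int k + \<theta>) < 2 * pi * \<theta>" using k(2) by simp
      show "2 * pi * \<theta> < 2 * pi" using theta(2) by simp
      show "\<exists>k'::int. 2 * pi * (of_int z * \<theta>) = 2 * pi * - \<theta> + 2 * pi * (of_int z * \<theta> - of_int k + \<theta>) + 2 * pi * k'"
        by (rule exI[of _ k]) (simp add: algebra_simps)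
      show "\<exists>k'::int. 0 = 2 * pi * - \<theta> + 2 * pi * \<theta> + 2 * pi * k'"
        by (rule exI[of _ 0]) simp
    qed
  qed
  finally show ?thesis .
qed

section \<open>Formulas versus relations on the integers\<close>

text \<open>Covers the three structures of the theorem, so that formulas are translated only once;
  the relation symbols are left arbitrary.\<close>

definition reduct :: "(fn_sym, rel_sym, complex) fo_struct \<Rightarrow> bool" where
  "reduct M \<longleftrightarrow> univ M = Gam r \<and> fn_interp M = fn_std r \<and> fn_arity M Mult = Some 2
     \<and> (\<forall>f k. fn_arity M f = Some k \<longrightarrow> fn_arity (G_struct r) f = Some k)"

definition rel_preds :: "(fn_sym, rel_sym, complex) fo_struct \<Rightarrow> ((nat \<Rightarrow> int) \<Rightarrow> bool) set" where
  "rel_preds M = {(\<lambda>w. map (\<lambda>i. h (w i)) [0..<k] \<in> rel_interp M p) | p k. rel_arity M p = Some k}"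

lemma rel_preds_supported: "R \<in> rel_preds M \<Longrightarrow> \<exists>K. supported K R"
proof -
  assume "R \<in> rel_preds M"
  then obtain p k where R: "R = (\<lambda>w. map (\<lambda>i. h (w i)) [0..<k] \<in> rel_interp M p)"
    by (auto simp: rel_preds_def)
  have "supported k R"
    unfolding supported_def
  proof (intro allI impI)
    fix w w' :: "nat \<Rightarrow> int" assume "\<forall>i<k. w i = w' i"
    then have "map (\<lambda>i. h (w i)) [0..<k] = map (\<lambda>i. h (w' i)) [0..<k]" by auto
    then show "R w = R w'" by (simp only: R)
  qed
  then show ?thesis ..
qed

text \<open>Multiplication and inversion act on exponents as addition and negation, and the
  generator contributes the constant 1.\<close>

lemma trm_val_affine:
  assumes "reduct M" and "wf_trm M t"
  shows "\<exists>g. aff g \<and> (\<forall>w. trm_val M (\<lambda>i. h (w i)) t = h (g w))"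
  using assms(2)
proof (induction t)
  case (Var i)
  show ?case using aff_var by auto
next
  case (Fn f ts)
  have M: "fn_interp M = fn_std r" "fn_arity (G_struct r) f = Some (length ts)"
    using assms(1) Fn.prems by (auto simp: reduct_def)
  have IH: "\<exists>g. aff g \<and> (\<forall>w. trm_val M (\<lambda>i. h (w i)) (ts ! i) = h (g w))" if "i < length ts" for i
    using Fn that by auto
  show ?case
  proof (cases f)
    case Mult
    then have len: "length ts = 2" using M by (simp add: G_struct_def)
    obtain g g' where "aff g" "\<forall>w. trm_val M (\<lambda>i. h (w i)) (ts ! 0) = h (g w)"
       "aff g'" "\<forall>w. trm_val M (\<lambda>i. h (w i)) (ts ! 1) = h (g' w)"
      using IH[of 0] IH[of 1] len by auto
    then show ?thesis
      by (intro exI[of _ "\<lambda>w. g w + g' w"]) (simp add: Mult M len gam_exp_add aff_intros)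
  next
    case Inv
    then have len: "length ts = 1" using M by (simp add: G_struct_def)
    obtain g where "aff g" "\<forall>w. trm_val M (\<lambda>i. h (w i)) (ts ! 0) = h (g w)"
      using IH[of 0] len by auto
    then show ?thesis
      by (intro exI[of _ "\<lambda>w. - g w"]) (simp add: Inv M len gam_exp_minus aff_intros)
  next
    case One
    then show ?thesis
      by (intro exI[of _ "\<lambda>w. 0"]) (simp add: One M aff_intros gam_exp_def)
  next
    case Gen
    then show ?thesis
      by (intro exI[of _ "\<lambda>w. 1"]) (simp add: Gen M aff_intros)
  qed
qed

lemma sat_dfn:
  assumes M: "reduct M" and "wf_fm M \<phi>"
  shows "(\<lambda>w. sat M (\<lambda>i. h (w i)) \<phi>) \<in> dfn (rel_preds M)"
  using assms(2)
proof (induction \<phi>)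
  case (Eq s t)
  then obtain g g' where g: "aff g" "\<And>w. trm_val M (\<lambda>i. h (w i)) s = h (g w)"
       "aff g'" "\<And>w. trm_val M (\<lambda>i. h (w i)) t = h (g' w)"
    using trm_val_affine[OF M, of s] trm_val_affine[OF M, of t] by auto
  then show ?case using dfn_eq[OF g(1,3)] by (simp add: h_inj)
next
  case (Rel p ts)
  have "\<exists>g. aff g \<and> (\<forall>w. trm_val M (\<lambda>i. h (w i)) (ts ! i) = h (g w))" if "i < length ts" for i
    using Rel that by (intro trm_val_affine[OF M]) auto
  then obtain G where G: "\<And>i. i < length ts \<Longrightarrow> aff (G i) \<and> (\<forall>w. trm_val M (\<lambda>i. h (w i)) (ts ! i) = h (G i w))"
    by metis
  \<comment> \<open>The default 0 makes the family of affine forms total, as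
    \<open>dfn_subst\<close> expects.\<close>
  define g where "g = (\<lambda>i. if i < length ts then G i else (\<lambda>w. 0))"
  have g: "aff (g i)" for i using G by (auto simp: g_def aff_const)
  let ?R = "\<lambda>w. map (\<lambda>i. h (w i)) [0..<length ts] \<in> rel_interp M p"
  have R: "?R \<in> rel_preds M" using Rel.prems by (auto simp: rel_preds_def)
  then obtain K where "supported K ?R" using rel_preds_supported by blast
  from dfn_subst[OF dfn.base[OF R] this g]
  have "(\<lambda>w. map (\<lambda>i. h (g i w)) [0..<length ts] \<in> rel_interp M p) \<in> dfn (rel_preds M)" .
  moreover have "map (\<lambda>i. h (g i w)) [0..<length ts] = map (trm_val M (\<lambda>i. h (w i))) ts" for w
    by (rule nth_equalityI) (auto simp: g_def G)
  ultimately show ?case by simp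
next
  case (Neg \<phi>)
  then show ?case using dfn.neg by simp
next
  case (Conj \<phi> \<psi>)
  then show ?case using dfn.conj by simp
next
  case (Ex i \<phi>)
  have "(\<lambda>j. h (w j))(i := h a) = (\<lambda>j. h ((w(i := a)) j))" for w :: "nat \<Rightarrow> int" and a by auto
  then have "sat M (\<lambda>i. h (w i)) (Ex i \<phi>) = (\<exists>a. sat M (\<lambda>j. h ((w(i := a)) j)) \<phi>)" for w
    using M by (simp add: reduct_def Gam_def)
  then show ?case using dfn.ex[OF Ex.IH, of i] Ex.prems by simp
qed

text \<open>In the formula witnessing \<open>expressible M R\<close>, the even variables stand for the arguments of \<open>R\<close> and
  the odd ones for parameters, so that parameters can be renamed apart.\<close>

definition interleave :: "(nat \<Rightarrow> 'a) \<Rightarrow> (nat \<Rightarrow> 'a) \<Rightarrow> nat \<Rightarrow> 'a" where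
  "interleave v p i = (if even i then v (i div 2) else p (i div 2))"

definition expressible :: "(fn_sym, rel_sym, complex) fo_struct \<Rightarrow> ((nat \<Rightarrow> int) \<Rightarrow> bool) \<Rightarrow> bool" where
  "expressible M R \<longleftrightarrow> (\<exists>\<phi> p. wf_fm M \<phi> \<and>
     (\<forall>w. R w = sat M (interleave (\<lambda>i. h (w i)) (\<lambda>i. h (p i))) \<phi>))"

lemma dfn_expressible:
  assumes M: "reduct M" and "R \<in> dfn (rel_preds M)"
  shows "expressible M R"
  using assms(2)
proof induction
  case (base R)
  then obtain p k where R: "rel_arity M p = Some k" "R = (\<lambda>w. map (\<lambda>i. h (w i)) [0..<k] \<in> rel_interp M p)"
    by (auto simp: rel_preds_def)
  show ?case
    unfolding expressible_def
    by (rule exI[of _ "Rel p (map (\<lambda>i. Var (2 * i)) [0..<k])"]) (auto simp: R interleave_def comp_def)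
next
  case (add i j k)
  show ?case
    unfolding expressible_def
    by (rule exI[of _ "Eq (Fn Mult [Var (2 * i), Var (2 * j)]) (Var (2 * k))"])
      (use M in \<open>auto simp: reduct_def interleave_def h_inj simp flip: gam_exp_add\<close>)
next
  case (const i c)
  show ?case
    unfolding expressible_def
    by (rule exI[of _ "Eq (Var (2 * i)) (Var 1)"], rule exI[of _ "\<lambda>_. c"])
      (auto simp: interleave_def h_inj)
next
  case (neg R)
  then obtain \<phi> p where
    "wf_fm M \<phi>" "\<And>w. R w = sat M (interleave (\<lambda>i. h (w i)) (\<lambda>i. h (p i))) \<phi>"
    unfolding expressible_def by blast
  then show ?case
    unfolding expressible_def by (intro exI[of _ "Neg \<phi>"] exI[of _ p]) simp
next
  case (conj R S)
  then obtain \<phi> p \<psi> q where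
    \<phi>: "wf_fm M \<phi>" "\<And>w. R w = sat M (interleave (\<lambda>i. h (w i)) (\<lambda>i. h (p i))) \<phi>" and
    \<psi>: "wf_fm M \<psi>" "\<And>w. S w = sat M (interleave (\<lambda>i. h (w i)) (\<lambda>i. h (q i))) \<psi>"
    unfolding expressible_def by blast
  \<comment> \<open>Arguments keep their place; parameter number j of the first (b = 0) or second (b
    = 1) formula becomes number 2 j + b, which is where \<open>interleave p q\<close> stores
    it.\<close>
  define \<rho> where "\<rho> = (\<lambda>b i. if even i then i else 2 * (2 * (i div 2) + b) + 1 :: nat)"
  define p' where "p' = interleave p q"
  have "sat M (interleave (\<lambda>i. h (w i)) (\<lambda>i. h (p' i))) (fm_rename (\<rho> 0) \<phi>) = R w" for w
    unfolding \<phi>(2) by (rule sat_rename) (auto simp: interleave_def p'_def \<rho>_def elim!: oddE)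
  moreover have "sat M (interleave (\<lambda>i. h (w i)) (\<lambda>i. h (p' i))) (fm_rename (\<rho> 1) \<psi>) = S w" for w
    unfolding \<psi>(2) by (rule sat_rename) (auto simp: interleave_def p'_def \<rho>_def elim!: oddE)
  ultimately show ?case
    unfolding expressible_def
    by (intro exI[of _ "Conj (fm_rename (\<rho> 0) \<phi>) (fm_rename (\<rho> 1) \<psi>)"] exI[of _ p'])
      (simp add: wf_fm_rename \<phi>(1) \<psi>(1))
next
  case (ex R i)
  then obtain \<phi> p where
    \<phi>: "wf_fm M \<phi>" "\<And>w. R w = sat M (interleave (\<lambda>i. h (w i)) (\<lambda>i. h (p i))) \<phi>"
    unfolding expressible_def by blast
  have "interleave (\<lambda>j. h ((w(i := a)) j)) (\<lambda>j. h (p j))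
      = (interleave (\<lambda>j. h (w j)) (\<lambda>j. h (p j)))(2 * i := h a)" for w a
    by (auto simp: interleave_def fun_eq_iff)
  then show ?case
    unfolding expressible_def using M
    by (intro exI[of _ "Ex (2 * i) \<phi>"] exI[of _ p]) (simp add: \<phi> reduct_def Gam_def)
next
  case (rename R \<rho>)
  then obtain \<phi> p where
    \<phi>: "wf_fm M \<phi>" "\<And>w. R w = sat M (interleave (\<lambda>i. h (w i)) (\<lambda>i. h (p i))) \<phi>"
    unfolding expressible_def by blast
  define \<rho>' where "\<rho>' = (\<lambda>i. if even i then 2 * \<rho> (i div 2) else i)"
  have "sat M (interleave (\<lambda>i. h (w i)) (\<lambda>i. h (p i))) (fm_rename \<rho>' \<phi>) = R (\<lambda>i. w (\<rho> i))" for w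
    unfolding \<phi>(2) by (rule sat_rename) (auto simp: interleave_def \<rho>'_def)
  then show ?case
    unfolding expressible_def
    by (intro exI[of _ "fm_rename \<rho>' \<phi>"] exI[of _ p]) (simp add: wf_fm_rename \<phi>(1))
qed

definition tuple_pred :: "nat \<Rightarrow> complex list set \<Rightarrow> (nat \<Rightarrow> int) \<Rightarrow> bool" where
  "tuple_pred n X w \<longleftrightarrow> map (\<lambda>i. h (w i)) [0..<n] \<in> X"

lemma tuple_pred_cong: "(\<And>i. i < n \<Longrightarrow> w i = w' i) \<Longrightarrow> tuple_pred n X w = tuple_pred n X w'"
  unfolding tuple_pred_def by (metis (no_types, lifting) atLeastLessThan_iff map_cong set_upt)

lemma map_h_tuples: "map (\<lambda>i. h (w i)) [0..<n] \<in> tuples n (Gam r)"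
  by (auto simp: tuples_def Gam_def)

lemma tuples_obtain:
  assumes "xs \<in> tuples n (Gam r)"
  obtains w where "xs = map (\<lambda>i. h (w i)) [0..<n]" "\<And>i. i \<ge> n \<Longrightarrow> w i = 0"
proof -
  have "\<exists>a. xs ! i = h a" if "i < n" for i
  proof -
    have "xs ! i \<in> Gam r" using assms that nth_mem[of i xs] unfolding tuples_def by blast
    then show ?thesis unfolding Gam_def by blast
  qed
  then obtain a where a: "\<And>i. i < n \<Longrightarrow> xs ! i = h (a i)" by metis
  have "xs = map (\<lambda>i. h (if i < n then a i else 0)) [0..<n]"
    using assms a by (intro nth_equalityI) (auto simp: tuples_def)
  then show ?thesis by (intro that[of "\<lambda>i. if i < n then a i else 0"]) auto
qed

text \<open>The bridge between the formal notion and \<open>dfn\<close>; after it only relations on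
  the integers matter.\<close>

theorem definable_iff_dfn:
  assumes M: "reduct M"
  shows "definable M n X \<longleftrightarrow> X \<subseteq> tuples n (Gam r) \<and> tuple_pred n X \<in> dfn (rel_preds M)"
proof
  assume "definable M n X"
  then obtain \<phi> v where \<phi>: "wf_fm M \<phi>" "\<forall>i. v i \<in> Gam r"
    and X: "X = {xs \<in> tuples n (Gam r). sat M (\<lambda>i. if i < n then xs ! i else v i) \<phi>}"
    using M by (auto simp: definable_def reduct_def)
  have "\<forall>i. \<exists>a. v i = h a" using \<phi>(2) unfolding Gam_def by blast
  then obtain c where c: "\<And>i. v i = h (c i)" by metis
  let ?S = "\<lambda>w. sat M (\<lambda>i. h (w i)) \<phi>"
  have S: "?S \<in> dfn (rel_preds M)" by (rule sat_dfn[OF M \<phi>(1)])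
  have "\<exists>K. supported K ?S" using S by (rule dfn_supported) (rule rel_preds_supported)
  then obtain K where K: "supported K ?S" ..
  have g: "aff (\<lambda>w. if i < n then w i else c i)" for i
    by (cases "i < n") (simp_all add: aff_var aff_const)
  have "(\<lambda>w. ?S (\<lambda>i. if i < n then w i else c i)) \<in> dfn (rel_preds M)"
    by (rule dfn_subst[OF S K g])
  moreover have "tuple_pred n X w = ?S (\<lambda>i. if i < n then w i else c i)" for w
  proof -
    have "tuple_pred n X w = sat M (\<lambda>i. if i < n then map (\<lambda>i. h (w i)) [0..<n] ! i else v i) \<phi>"
      using map_h_tuples by (simp add: tuple_pred_def X)
    also have "(\<lambda>i. if i < n then map (\<lambda>i. h (w i)) [0..<n] ! i else v i)
        = (\<lambda>i. h (if i < n then w i else c i))" using c by auto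
    finally show ?thesis .
  qed
  ultimately have "tuple_pred n X \<in> dfn (rel_preds M)" by presburger
  then show "X \<subseteq> tuples n (Gam r) \<and> tuple_pred n X \<in> dfn (rel_preds M)" using X by auto
next
  assume X: "X \<subseteq> tuples n (Gam r) \<and> tuple_pred n X \<in> dfn (rel_preds M)"
  then obtain \<phi> p where
    \<phi>: "wf_fm M \<phi>" "\<And>w. tuple_pred n X w = sat M (interleave (\<lambda>i. h (w i)) (\<lambda>i. h (p i))) \<phi>"
    using dfn_expressible[OF M] unfolding expressible_def by blast
  \<comment> \<open>Positions below n hold the tuple, position n stands for all remaining argument
    variables, and parameter number j moves to n + 1 + j. The value \<open>h 0\<close> at position n
    agrees with the padding by 0 in \<open>tuples_obtain\<close>.\<close>
  define \<rho> where "\<rho> = (\<lambda>i. if even i then min (i div 2) n else Suc (n + i div 2))"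
  define v where "v = (\<lambda>i. if i \<le> n then h 0 else h (p (i - Suc n)))"
  have "xs \<in> X \<longleftrightarrow> sat M (\<lambda>i. if i < n then xs ! i else v i) (fm_rename \<rho> \<phi>)"
    if xs: "xs \<in> tuples n (Gam r)" for xs
  proof -
    obtain w where w: "xs = map (\<lambda>i. h (w i)) [0..<n]" "\<And>i. i \<ge> n \<Longrightarrow> w i = 0"
      using tuples_obtain[OF xs] by blast
    have "xs \<in> X \<longleftrightarrow> tuple_pred n X w" by (simp add: tuple_pred_def w(1))
    also have "\<dots> \<longleftrightarrow> sat M (\<lambda>i. if i < n then xs ! i else v i) (fm_rename \<rho> \<phi>)"
      unfolding \<phi>(2)
      by (rule sat_rename[symmetric]) (auto simp: interleave_def \<rho>_def v_def w min_def)
    finally show ?thesis .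
  qed
  then have "X = {xs \<in> tuples n (Gam r). sat M (\<lambda>i. if i < n then xs ! i else v i) (fm_rename \<rho> \<phi>)}"
    using X by auto
  moreover have "v i \<in> Gam r" for i by (simp add: v_def Gam_def)
  ultimately show "definable M n X"
    using M \<phi>(1) unfolding definable_def reduct_def
    by (intro exI[of _ "fm_rename \<rho> \<phi>"] exI[of _ v]) (simp add: wf_fm_rename)
qed

end

section \<open>Back and forth in the group generated by 1 and the rotation angle\<close>

text \<open>Finite configurations in the same order have corresponding gaps. \<open>lo\<close> and
  \<open>hi\<close> bound the gap of \<open>v\<close> on both sides; its counterpart lies between
  the largest image from below and the smallest image from above.\<close>

lemma order_transfer_gap:
  fixes \<rho> \<rho>' :: "'i \<Rightarrow> real"
  assumes I: "finite I" and iso: "\<And>i j. i \<in> I \<Longrightarrow> j \<in> I \<Longrightarrow> sgn (\<rho> i - \<rho> j) = sgn (\<rho>' i - \<rho>' j)"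
    and lo: "lo \<in> I" "\<rho> lo < v" and hi: "hi \<in> I" "v < \<rho> hi" and v: "\<And>i. i \<in> I \<Longrightarrow> v \<noteq> \<rho> i"
  obtains a b where "a < b" "\<And>v' i. a < v' \<Longrightarrow> v' < b \<Longrightarrow> i \<in> I \<Longrightarrow> sgn (v - \<rho> i) = sgn (v' - \<rho>' i)"
proof -
  define L U where "L = {i \<in> I. \<rho> i < v}" and "U = {i \<in> I. v < \<rho> i}"
  have fin: "finite L" "finite U" "L \<noteq> {}" "U \<noteq> {}"
    using I lo hi by (auto simp: L_def U_def)
  have less: "\<rho>' i < \<rho>' j" if "i \<in> L" "j \<in> U" for i j
    using iso[of i j] that by (auto simp: L_def U_def sgn_if split: if_splits)
  define a b where "a = Max (\<rho>' ` L)" and "b = Min (\<rho>' ` U)"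
  have "a \<in> \<rho>' ` L" "b \<in> \<rho>' ` U"
    using fin by (auto simp: a_def b_def)
  then have "a < b" using less by auto
  moreover have "sgn (v - \<rho> i) = sgn (v' - \<rho>' i)" if v': "a < v'" "v' < b" and i: "i \<in> I" for v' i
  proof (cases "\<rho> i < v")
    case True
    then have "\<rho>' i \<le> a" using i fin by (auto simp: a_def L_def)
    then show ?thesis using True v' by simp
  next
    case False
    then have *: "v < \<rho> i" using v[OF i] by auto
    then have "b \<le> \<rho>' i" using i fin by (auto simp: b_def U_def)
    then show ?thesis using * v' by simp
  qed
  ultimately show ?thesis by (rule that)
qed

context beatty
begin

section \<open>Congruence modulo multiples of the dense group\<close>

text \<open>Congruence modulo N A for A = Z + Z \<theta>, on arbitrary reals: the constants of
  affine forms need not lie in A.\<close>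

definition cong_lat :: "int \<Rightarrow> real \<Rightarrow> real \<Rightarrow> bool" where
  "cong_lat N u v \<longleftrightarrow> (\<exists>a b::int. v = u + of_int N * (of_int a * \<theta> - of_int b))"

lemma cong_latI: "v = u + of_int N * (of_int a * \<theta> - of_int b) \<Longrightarrow> cong_lat N u v"
  unfolding cong_lat_def by blast

lemma cong_lat_refl: "cong_lat N u u"
  by (rule cong_latI[of _ _ _ 0 0]) simp

lemma cong_lat_sym: "cong_lat N u v \<Longrightarrow> cong_lat N v u"
proof -
  assume "cong_lat N u v"
  then obtain a b :: int where "v = u + of_int N * (of_int a * \<theta> - of_int b)"
    unfolding cong_lat_def by blast
  then show ?thesis by (intro cong_latI[of _ _ _ "- a" "- b"]) (simp add: algebra_simps)
qed

lemma cong_lat_dvd: "cong_lat N u v \<Longrightarrow> M dvd N \<Longrightarrow> cong_lat M u v"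
proof -
  assume "cong_lat N u v" "M dvd N"
  then obtain a b where "v = u + of_int N * (of_int a * \<theta> - of_int b)"
    unfolding cong_lat_def by blast
  moreover obtain c where "N = M * c" using \<open>M dvd N\<close> by (rule dvdE)
  ultimately show ?thesis by (intro cong_latI[of _ _ _ "c * a" "c * b"]) (simp add: algebra_simps)
qed

lemma cong_lat_diff: "cong_lat N u v \<Longrightarrow> cong_lat N u' v' \<Longrightarrow> cong_lat N (u - u') (v - v')"
proof -
  assume "cong_lat N u v" "cong_lat N u' v'"
  then obtain a b a' b' :: int where "v = u + of_int N * (of_int a * \<theta> - of_int b)"
     "v' = u' + of_int N * (of_int a' * \<theta> - of_int b')"
    unfolding cong_lat_def by blast
  then show ?thesis by (intro cong_latI[of _ _ _ "a - a'" "b - b'"]) (simp add: algebra_simps)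
qed

text \<open>By Kronecker's theorem A is dense in the reals, hence so is every coset of N A.\<close>

lemma cong_lat_dense:
  assumes "a < b" and "N > 0"
  shows "\<exists>v. a < v \<and> v < b \<and> cong_lat N u v"
proof -
  have N: "real_of_int N > 0" using assms by simp
  have "(b - a) / (2 * of_int N) > 0" using assms N by simp
  from sequence_of_fractional_parts_is_dense[OF theta(3) this] obtain x y :: int where
    xy: "\<bar>of_int x * \<theta> - of_int y - ((a + b) / 2 - u) / of_int N\<bar> < (b - a) / (2 * of_int N)"
    by metis
  define v where "v = u + of_int N * (of_int x * \<theta> - of_int y)"
  have "v - (a + b) / 2 = of_int N * (of_int x * \<theta> - of_int y - ((a + b) / 2 - u) / of_int N)"
    using N by (simp add: v_def field_simps)
  then have "\<bar>v - (a + b) / 2\<bar> = of_int N * \<bar>of_int x * \<theta> - of_int y - ((a + b) / 2 - u) / of_int N\<bar>"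
    using N by (simp only: abs_mult)
  also have "\<dots> < of_int N * ((b - a) / (2 * of_int N))"
    using xy N by (rule mult_strict_left_mono)
  also have "\<dots> = (b - a) / 2" using N by simp
  finally have "a < v" "v < b" by (auto simp: abs_if field_simps split: if_splits)
  then show ?thesis using cong_latI[OF v_def] by blast
qed

lemma lin_cong_lat:
  "lin f g \<Longrightarrow> (\<And>i. cong_lat N (x i) (x' i)) \<Longrightarrow> cong_lat N (f x) (f x')"
  by (induction rule: lin.induct) (auto intro: cong_lat_refl cong_lat_diff)

section \<open>Elimination of quantifiers up to similarity\<close>

definition \<xi> :: "(nat \<Rightarrow> int) \<Rightarrow> nat \<Rightarrow> real" where
  "\<xi> w i = frac (\<theta> * of_int (w i))"

lemma xi_update: "\<xi> (w(i := a)) = (\<xi> w)(i := frac (\<theta> * of_int a))"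
  by (auto simp: \<xi>_def)

lemma frac_floor: "frac (\<theta> * of_int a) = of_int a * \<theta> - of_int \<lfloor>\<theta> * of_int a\<rfloor>"
  by (simp add: frac_def)

definition sim :: "int \<Rightarrow> (((nat \<Rightarrow> real) \<Rightarrow> real) \<times> ((nat \<Rightarrow> int) \<Rightarrow> int)) set \<Rightarrow>
    (nat \<Rightarrow> int) \<Rightarrow> (nat \<Rightarrow> int) \<Rightarrow> bool" where
  "sim N F w w' \<longleftrightarrow> (\<forall>i. cong_lat N (\<xi> w i) (\<xi> w' i)) \<and> (\<forall>(f, g)\<in>F. sgn (f (\<xi> w)) = sgn (f (\<xi> w')))"

text \<open>A semantic form of quantifier elimination: the congruence classes of the coordinates and
  finitely many signs decide \<open>R\<close>. The integer form in each pair is carried along so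
  that zeros of the real form can later be read as equations.\<close>

definition tame_wrt :: "int \<Rightarrow> (((nat \<Rightarrow> real) \<Rightarrow> real) \<times> ((nat \<Rightarrow> int) \<Rightarrow> int)) set \<Rightarrow>
    ((nat \<Rightarrow> int) \<Rightarrow> bool) \<Rightarrow> bool" where
  "tame_wrt N F R \<longleftrightarrow> N > 0 \<and> finite F \<and> (\<forall>(f, g)\<in>F. lin f g) \<and> (\<forall>w w'. sim N F w w' \<longrightarrow> R w = R w')"

lemma tame_wrtI:
  assumes "N > 0" "finite F" "\<And>f g. (f, g) \<in> F \<Longrightarrow> lin f g" "\<And>w w'. sim N F w w' \<Longrightarrow> R w = R w'"
  shows "tame_wrt N F R"
  using assms unfolding tame_wrt_def by blast

lemma sim_sym: "sim N F w w' \<Longrightarrow> sim N F w' w"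
  unfolding sim_def by (auto intro: cong_lat_sym)

lemma sim_mono: "sim N F w w' \<Longrightarrow> M dvd N \<Longrightarrow> G \<subseteq> F \<Longrightarrow> sim M G w w'"
  unfolding sim_def by (blast intro: cong_lat_dvd)

lemma tame_conj:
  assumes "tame_wrt N F R" "tame_wrt M G S"
  shows "tame_wrt (N * M) (F \<union> G) (\<lambda>w. R w \<and> S w)"
proof (rule tame_wrtI)
  fix w w' assume "sim (N * M) (F \<union> G) w w'"
  then have "sim N F w w'" "sim M G w w'" by (auto elim: sim_mono)
  then show "(R w \<and> S w) = (R w' \<and> S w')" using assms unfolding tame_wrt_def by blast
qed (use assms in \<open>auto simp: tame_wrt_def\<close>)

lemma tame_rename:
  assumes "tame_wrt N F R"
  shows "tame_wrt N ((\<lambda>(f, g). (\<lambda>x. f (\<lambda>i. x (\<rho> i)), \<lambda>w. g (\<lambda>i. w (\<rho> i)))) ` F) (\<lambda>w. R (\<lambda>i. w (\<rho> i)))"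
    (is "tame_wrt N ?F _")
proof (rule tame_wrtI)
  fix w w' assume s: "sim N ?F w w'"
  have \<xi>: "\<xi> (\<lambda>i. w (\<rho> i)) = (\<lambda>i. \<xi> w (\<rho> i))" for w by (auto simp: \<xi>_def)
  have "sim N F (\<lambda>i. w (\<rho> i)) (\<lambda>i. w' (\<rho> i))"
    using s unfolding sim_def \<xi> by auto
  then show "R (\<lambda>i. w (\<rho> i)) = R (\<lambda>i. w' (\<rho> i))" using assms unfolding tame_wrt_def by blast
qed (use assms in \<open>auto simp: tame_wrt_def intro: lin_rename\<close>)

text \<open>The cross differences compare the zeros of the forms in the variable, so these zeros are
  ordered alike on both sides. If \<open>v\<close> is a zero, its counterpart is the only choice for
  \<open>v'\<close>; otherwise density provides \<open>v'\<close> in the corresponding gap.\<close>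

lemma affine_back_and_forth:
  fixes k :: "'i \<Rightarrow> int" and G G' :: "'i \<Rightarrow> real"
  assumes N: "N > 0" and F: "finite F"
    and N': "\<And>p. p \<in> F \<Longrightarrow> k p \<noteq> 0 \<Longrightarrow> k p * N dvd N'"
    and G: "\<And>p. p \<in> F \<Longrightarrow> cong_lat N' (G p) (G' p)"
    and sgn: "\<And>p q. p \<in> F \<Longrightarrow> q \<in> F \<Longrightarrow>
       sgn (of_int (k p) * G q - of_int (k q) * G p) = sgn (of_int (k p) * G' q - of_int (k q) * G' p)"
    and lo: "lo \<in> F" "k lo \<noteq> 0" "- G lo / of_int (k lo) \<le> v"
    and hi: "hi \<in> F" "k hi \<noteq> 0" "v < - G hi / of_int (k hi)"
  shows "\<exists>v'. cong_lat N v v' \<and> (\<forall>p\<in>F. sgn (of_int (k p) * v + G p) = sgn (of_int (k p) * v' + G' p))"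
proof -
  define I where "I = {p \<in> F. k p \<noteq> 0}"
  define \<rho> \<rho>' where "\<rho> p = - G p / of_int (k p)" and "\<rho>' p = - G' p / of_int (k p)" for p
  have diff: "- x / a - - y / b = (a * y - b * x) / (a * b)" if "a \<noteq> 0" "b \<noteq> 0" for a b x y :: real
    using that by (simp add: field_simps)
  have iso: "sgn (\<rho> p - \<rho> q) = sgn (\<rho>' p - \<rho>' q)" if "p \<in> I" "q \<in> I" for p q
  proof -
    have k: "real_of_int (k p) \<noteq> 0" "real_of_int (k q) \<noteq> 0" and s: "p \<in> F" "q \<in> F"
      using that by (auto simp: I_def)
    show ?thesis unfolding \<rho>_def \<rho>'_def diff[OF k] sgn_divide sgn[OF s] ..
  qed
  have red: "sgn (of_int (k p) * v + G p) = sgn (of_int (k p) * v' + G' p)"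
    if v': "\<And>p. p \<in> I \<Longrightarrow> sgn (v - \<rho> p) = sgn (v' - \<rho>' p)" and p: "p \<in> F" for v' p
  proof (cases "k p = 0")
    case True
    \<comment> \<open>A form without the variable has no zero to compare; its sign is recovered from
      the cross difference with \<open>lo\<close>.\<close>
    have "sgn (of_int (k lo)) * sgn (G p) = sgn (of_int (k lo)) * sgn (G' p)"
      using sgn[OF lo(1) p] True by (simp add: sgn_mult)
    then show ?thesis using True lo(2) by (simp add: sgn_zero_iff sgn_0_0)
  next
    case False
    then have "of_int (k p) * v + G p = of_int (k p) * (v - \<rho> p)"
      "of_int (k p) * v' + G' p = of_int (k p) * (v' - \<rho>' p)"
      by (auto simp: \<rho>_def \<rho>'_def algebra_simps)
    then show ?thesis using v'[of p] p False by (simp add: sgn_mult I_def)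
  qed
  show ?thesis
  proof (cases "\<exists>p\<in>I. v = \<rho> p")
    case True
    then obtain p where p: "p \<in> I" "v = \<rho> p" by blast
    then have kp: "p \<in> F" "k p \<noteq> 0" by (auto simp: I_def)
    obtain a b :: int where ab: "G' p = G p + of_int N' * (of_int a * \<theta> - of_int b)"
      using G[OF kp(1)] unfolding cong_lat_def by blast
    obtain m where m: "N' = k p * N * m" using N'[OF kp] by (auto elim: dvdE)
    \<comment> \<open>Dividing by \<open>k p\<close> costs a factor \<open>k p\<close> in the
      modulus, which \<open>N'\<close> has in reserve.\<close>
    have "\<rho>' p = \<rho> p + of_int N * (of_int (- m * a) * \<theta> - of_int (- m * b))"
      using kp(2) unfolding \<rho>_def \<rho>'_def ab m by (simp add: field_simps)
    then have "cong_lat N v (\<rho>' p)" unfolding p(2) by (rule cong_latI)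
    moreover have "sgn (v - \<rho> q) = sgn (\<rho>' p - \<rho>' q)" if "q \<in> I" for q
      using iso[OF p(1) that] p(2) by simp
    ultimately show ?thesis using red by blast
  next
    case False
    have "finite I" "lo \<in> I" "hi \<in> I" using F lo hi by (auto simp: I_def)
    moreover have "\<rho> lo < v" "v < \<rho> hi"
      using lo hi False \<open>lo \<in> I\<close> by (force simp: \<rho>_def)+
    ultimately obtain a b where "a < b"
      and ab: "\<And>v' i. a < v' \<Longrightarrow> v' < b \<Longrightarrow> i \<in> I \<Longrightarrow> sgn (v - \<rho> i) = sgn (v' - \<rho>' i)"
      using order_transfer_gap[of I \<rho> \<rho>' lo v hi] iso False by metis
    then obtain v' where "a < v'" "v' < b" "cong_lat N v v'" using cong_lat_dense[OF _ N] by blast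
    then show ?thesis using red ab by blast
  qed
qed

text \<open>Elimination in the manner of Fourier and Motzkin: the signs of the cross combinations of
  all pairs of forms, together with congruences to a larger modulus, decide which conditions a value
  of the bound variable can meet.\<close>

lemma tame_ex:
  assumes R: "tame_wrt N F R"
  shows "\<exists>N' F'. tame_wrt N' F' (\<lambda>w. \<exists>a. R (w(i := a)))"
proof -
  \<comment> \<open>Two additional forms encode 0 \<le> v < 1, so that the new value is again a
    fractional part; they also serve as \<open>lo\<close> and \<open>hi\<close> of the
    back-and-forth step.\<close>
  define p0 p1 :: "((nat \<Rightarrow> real) \<Rightarrow> real) \<times> ((nat \<Rightarrow> int) \<Rightarrow> int)"
    where "p0 = (\<lambda>x. x i, \<lambda>w. w i)" and "p1 = (\<lambda>x. x i - 1, \<lambda>w. w i - 0)"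
  define F1 where "F1 = F \<union> {p0, p1}"
  have F1: "finite F1" and N: "N > 0" using R by (auto simp: F1_def tame_wrt_def)
  have "\<exists>k f0 g0. lin f0 g0 \<and> (\<forall>x. fst p x = of_int k * x i + f0 x) \<and> (\<forall>x a. f0 (x(i := a)) = f0 x)"
    if "p \<in> F1" for p
  proof -
    have "lin (fst p) (snd p)"
      using that R lin_var[of i] lin_diff[OF lin_var[of i] lin_const[of 1 0]]
      by (auto simp: F1_def tame_wrt_def p0_def p1_def)
    from lin_split[OF this, of i] show ?thesis by blast
  qed
  then obtain k f0 g0 where lin0: "\<And>p. p \<in> F1 \<Longrightarrow> lin (f0 p) (g0 p)"
    and split: "\<And>p x. p \<in> F1 \<Longrightarrow> fst p x = of_int (k p) * x i + f0 p x"
    and indep: "\<And>p x a. p \<in> F1 \<Longrightarrow> f0 p (x(i := a)) = f0 p x" by metis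
  have p01: "k p0 = 1" "f0 p0 x = 0" "k p1 = 1" "f0 p1 x = - 1" for x
  proof -
    have *: "p0 \<in> F1" "p1 \<in> F1" by (auto simp: F1_def)
    show "f0 p0 x = 0" "f0 p1 x = - 1" for x
      using split[OF *(1), of "x(i := 0)"] indep[OF *(1), of x 0]
        split[OF *(2), of "x(i := 0)"] indep[OF *(2), of x 0] by (auto simp: p0_def p1_def)
    then have "real_of_int (k p0) = 1" "real_of_int (k p1) = 1"
      using split[OF *(1), of "\<lambda>_. 1"] split[OF *(2), of "\<lambda>_. 1"] by (auto simp: p0_def p1_def)
    then show "k p0 = 1" "k p1 = 1" by simp_all
  qed
  define N' where "N' = N * (\<Prod>p\<in>F1. if k p = 0 then 1 else \<bar>k p\<bar>)"
  define F' where "F' = (\<lambda>(p, q). (\<lambda>x. of_int (k p) * f0 q x - of_int (k q) * f0 p x,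
                                  \<lambda>w. k p * g0 q w - k q * g0 p w)) ` (F1 \<times> F1)"
  have half: "\<exists>a'. R (w'(i := a'))" if s: "sim N' F' w w'" and Ra: "R (w(i := a))" for w w' a
  proof -
    define v where "v = frac (\<theta> * of_int a)"
    have v: "0 \<le> v" "v < 1" by (auto simp: v_def frac_lt_1)
    have "\<exists>v'. cong_lat N v v' \<and>
        (\<forall>p\<in>F1. sgn (of_int (k p) * v + f0 p (\<xi> w)) = sgn (of_int (k p) * v' + f0 p (\<xi> w')))"
    proof (rule affine_back_and_forth[where lo = p0 and hi = p1 and N' = N'])
      show "k p * N dvd N'" if "p \<in> F1" "k p \<noteq> 0" for p
      proof -
        have "(if k p = 0 then 1 else \<bar>k p\<bar>) dvd (\<Prod>p\<in>F1. if k p = 0 then 1 else \<bar>k p\<bar>)"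
          using F1 that(1) by (rule dvd_prodI)
        then have "k p dvd (\<Prod>p\<in>F1. if k p = 0 then 1 else \<bar>k p\<bar>)" using that(2) by simp
        then show ?thesis unfolding N'_def by (subst mult.commute) (rule mult_dvd_mono, simp)
      qed
      show "cong_lat N' (f0 p (\<xi> w)) (f0 p (\<xi> w'))" if "p \<in> F1" for p
        using s by (intro lin_cong_lat[OF lin0[OF that]]) (simp add: sim_def)
      show "sgn (of_int (k p) * f0 q (\<xi> w) - of_int (k q) * f0 p (\<xi> w))
          = sgn (of_int (k p) * f0 q (\<xi> w') - of_int (k q) * f0 p (\<xi> w'))" if "p \<in> F1" "q \<in> F1" for p q
        using s that unfolding sim_def F'_def by force
    qed (use N F1 v in \<open>auto simp: p01 F1_def\<close>)
    then obtain v' where v': "cong_lat N v v'"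
      and eq: "\<And>p. p \<in> F1 \<Longrightarrow> sgn (of_int (k p) * v + f0 p (\<xi> w)) = sgn (of_int (k p) * v' + f0 p (\<xi> w'))"
      by blast
    have eq': "sgn (f ((\<xi> w)(i := v))) = sgn (f ((\<xi> w')(i := v')))" if "(f, g) \<in> F1" for f g
      using eq[OF that] split[OF that] indep[OF that] by simp
    have "sgn v = sgn v'" "sgn (v - 1) = sgn (v' - 1)"
      using eq'[of "fst p0" "snd p0"] eq'[of "fst p1" "snd p1"] by (auto simp: p0_def p1_def F1_def)
    then have v'01: "0 \<le> v'" "v' < 1"
      using v by (auto simp: sgn_if split: if_splits)
    obtain x y :: int where xy: "v' = v + of_int N * (of_int x * \<theta> - of_int y)"
      using v' unfolding cong_lat_def by blast
    \<comment> \<open>The integer with angle v': adding N x to \<open>a\<close> adds N x \<theta> to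
      the angle, and N y is absorbed by the floor.\<close>
    define a' where "a' = a + N * x"
    have "\<theta> * of_int a' = v' + of_int (\<lfloor>\<theta> * of_int a\<rfloor> + N * y)"
      unfolding xy v_def frac_def a'_def by (simp add: algebra_simps)
    then have fr: "frac (\<theta> * of_int a') = v'"
      using v'01 by (simp add: frac_unique_iff)
    have "sim N F (w(i := a)) (w'(i := a'))"
      unfolding sim_def
    proof (intro conjI allI)
      show "cong_lat N (\<xi> (w(i := a)) j) (\<xi> (w'(i := a')) j)" for j
      proof (cases "j = i")
        case True
        then show ?thesis using v' by (simp add: xi_update fr flip: v_def)
      next
        case False
        then show ?thesis using s cong_lat_dvd[of N' _ _ N] by (simp add: xi_update sim_def N'_def)
      qed
      show "\<forall>(f, g)\<in>F. sgn (f (\<xi> (w(i := a)))) = sgn (f (\<xi> (w'(i := a'))))"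
        using eq' by (auto simp: xi_update fr F1_def simp flip: v_def simp del: fun_upd_apply)
    qed
    then have "R (w'(i := a'))" using R Ra unfolding tame_wrt_def by blast
    then show ?thesis ..
  qed
  have "tame_wrt N' F' (\<lambda>w. \<exists>a. R (w(i := a)))"
  proof (rule tame_wrtI)
    show "N' > 0" using N by (auto simp: N'_def intro!: mult_pos_pos prod_pos)
    show "finite F'" using F1 by (simp add: F'_def)
    show "lin f g" if "(f, g) \<in> F'" for f g
      using that lin0 by (auto simp: F'_def intro!: lin_diff lin_scale)
    show "(\<exists>a. R (w(i := a))) = (\<exists>a. R (w'(i := a)))" if "sim N' F' w w'" for w w'
      using half[OF that] half[OF sim_sym[OF that]] by blast
  qed
  then show ?thesis by blast
qed

definition beatty_pred :: "(nat \<Rightarrow> int) \<Rightarrow> bool" where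
  "beatty_pred w \<longleftrightarrow> h (w 0) \<in> P_set r"

lemma beatty_pred_xi: "beatty_pred w \<longleftrightarrow> 1 - \<theta> < \<xi> w 0"
proof
  assume "beatty_pred w"
  then obtain k :: int where k: "- \<theta> < of_int (w 0) * \<theta> - of_int k" "of_int (w 0) * \<theta> - of_int k < 0"
    unfolding beatty_pred_def P_set_iff by blast
  then have "\<lfloor>\<theta> * of_int (w 0)\<rfloor> = k - 1"
    using theta by (intro floor_unique) (auto simp: algebra_simps)
  then show "1 - \<theta> < \<xi> w 0" using k by (simp add: \<xi>_def frac_def algebra_simps)
next
  assume "1 - \<theta> < \<xi> w 0"
  moreover have "\<xi> w 0 < 1" by (simp add: \<xi>_def frac_lt_1)
  ultimately show "beatty_pred w"
    unfolding beatty_pred_def P_set_iff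
    by (intro exI[of _ "\<lfloor>\<theta> * of_int (w 0)\<rfloor> + 1"]) (auto simp: \<xi>_def frac_def algebra_simps)
qed

text \<open>Induction on the construction of \<open>R\<close>; only the existential quantifier needs
  the back-and-forth argument.\<close>

theorem dfn_tame:
  assumes "R \<in> dfn {beatty_pred}"
  shows "\<exists>N F. tame_wrt N F R"
  using assms
proof induction
  case (base R)
  have "tame_wrt 1 {(\<lambda>x. x 0 - (1 - \<theta>), \<lambda>w. w 0 - 1)} beatty_pred"
  proof (rule tame_wrtI)
    fix w w' assume "sim 1 {(\<lambda>x. x 0 - (1 - \<theta>), \<lambda>w. w 0 - 1)} w w'"
    then have "sgn (\<xi> w 0 - (1 - \<theta>)) = sgn (\<xi> w' 0 - (1 - \<theta>))" unfolding sim_def by auto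
    then show "beatty_pred w = beatty_pred w'"
      unfolding beatty_pred_xi by (auto simp: sgn_if split: if_splits)
  qed (auto intro!: lin_diff lin_var lin_const)
  then show ?case using base by auto
next
  case (add i j k)
  \<comment> \<open>For angles in [0, 1), the sum of two exceeds the angle of the sum by a carry of
    0 or 1; irrationality gives the converse.\<close>
  have eq: "w i + w j = w k \<longleftrightarrow> \<xi> w i + \<xi> w j - \<xi> w k = 0 \<or> \<xi> w i + \<xi> w j - \<xi> w k - 1 = 0" for w
  proof -
    define m where "m = \<lfloor>\<theta> * of_int (w k)\<rfloor> - \<lfloor>\<theta> * of_int (w i)\<rfloor> - \<lfloor>\<theta> * of_int (w j)\<rfloor>"
    have d: "\<xi> w i + \<xi> w j - \<xi> w k = of_int (w i + w j - w k) * \<theta> + of_int m"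
      by (simp add: \<xi>_def frac_floor m_def algebra_simps)
    have b: "0 \<le> \<xi> w l" "\<xi> w l < 1" for l by (auto simp: \<xi>_def frac_lt_1)
    show ?thesis
    proof
      assume "w i + w j = w k"
      then have e: "\<xi> w i + \<xi> w j - \<xi> w k = of_int m" using d by simp
      then have "- 1 < real_of_int m" "real_of_int m < 2" using b[of i] b[of j] b[of k] by linarith+
      then have "m = 0 \<or> m = 1" by linarith
      then show "\<xi> w i + \<xi> w j - \<xi> w k = 0 \<or> \<xi> w i + \<xi> w j - \<xi> w k - 1 = 0" using e by auto
    next
      assume "\<xi> w i + \<xi> w j - \<xi> w k = 0 \<or> \<xi> w i + \<xi> w j - \<xi> w k - 1 = 0"
      then have "of_int (w i + w j - w k) * \<theta> = of_int (- m) \<or> of_int (w i + w j - w k) * \<theta> = of_int (1 - m)"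
        using d by auto
      then have "w i + w j - w k = 0" using int_theta_eq by blast
      then show "w i + w j = w k" by simp
    qed
  qed
  let ?F = "{(\<lambda>x. x i - (x k - x j), \<lambda>w. w i - (w k - w j)), (\<lambda>x. x i - (x k - x j) - 1, \<lambda>w. w i - (w k - w j) - 1)}"
  have "tame_wrt 1 ?F (\<lambda>w. w i + w j = w k)"
  proof (rule tame_wrtI)
    fix w w' assume "sim 1 ?F w w'"
    then have "sgn (\<xi> w i + \<xi> w j - \<xi> w k) = sgn (\<xi> w' i + \<xi> w' j - \<xi> w' k)"
      "sgn (\<xi> w i + \<xi> w j - \<xi> w k - 1) = sgn (\<xi> w' i + \<xi> w' j - \<xi> w' k - 1)"
      unfolding sim_def by (auto simp: algebra_simps)
    then show "(w i + w j = w k) = (w' i + w' j = w' k)"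
      unfolding eq by (metis sgn_zero_iff)
  qed (auto intro!: lin_diff lin_var lin_const)
  then show ?case by blast
next
  case (const i c)
  have eq: "w i = c \<longleftrightarrow> \<xi> w i - frac (\<theta> * of_int c) = 0" for w
  proof
    assume "\<xi> w i - frac (\<theta> * of_int c) = 0"
    then have "of_int (w i - c) * \<theta> = of_int (\<lfloor>\<theta> * of_int (w i)\<rfloor> - \<lfloor>\<theta> * of_int c\<rfloor>)"
      by (simp add: \<xi>_def frac_def algebra_simps)
    from int_theta_eq[OF this] show "w i = c" by simp
  qed (simp add: \<xi>_def)
  have "tame_wrt 1 {(\<lambda>x. x i - frac (\<theta> * of_int c), \<lambda>w. w i - 1)} (\<lambda>w. w i = c)"
  proof (rule tame_wrtI)
    fix w w' assume "sim 1 {(\<lambda>x. x i - frac (\<theta> * of_int c), \<lambda>w. w i - 1)} w w'"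
    then have "sgn (\<xi> w i - frac (\<theta> * of_int c)) = sgn (\<xi> w' i - frac (\<theta> * of_int c))"
      unfolding sim_def by auto
    then show "(w i = c) = (w' i = c)" unfolding eq by (metis sgn_zero_iff)
  qed (auto intro!: lin_diff lin_var lin_const)
  then show ?case by blast
next
  case (neg R)
  then show ?case unfolding tame_wrt_def by blast
next
  case (conj R S)
  then show ?case using tame_conj by blast
next
  case (ex R i)
  then show ?case using tame_ex by blast
next
  case (rename R \<rho>)
  then obtain N F where "tame_wrt N F R" by blast
  from tame_rename[OF this] show ?case by blast
qed

end

section \<open>Recovering the arc from a step function\<close>

lemma finite_common_radius:
  fixes Q :: "'i \<Rightarrow> real \<Rightarrow> bool"
  assumes "finite S" and "\<And>b. b \<in> S \<Longrightarrow> \<exists>\<epsilon>>0. Q b \<epsilon>" 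
    and mono: "\<And>b \<epsilon> \<delta>. Q b \<epsilon> \<Longrightarrow> 0 < \<delta> \<Longrightarrow> \<delta> \<le> \<epsilon> \<Longrightarrow> Q b \<delta>"
  shows "\<exists>\<epsilon>>0. \<forall>b\<in>S. Q b \<epsilon>"
  using assms(1,2)
proof (induction S rule: finite_induct)
  case empty
  show ?case by (rule exI[of _ 1]) simp
next
  case (insert x S)
  then obtain \<epsilon> \<delta> where "\<epsilon> > 0" "\<forall>b\<in>S. Q b \<epsilon>" "\<delta> > 0" "Q x \<delta>" by (metis insert_iff)
  then show ?case
    by (intro exI[of _ "min \<epsilon> \<delta>"]) (auto intro: mono[of _ \<epsilon>] mono[of _ \<delta>])
qed

text \<open>Each e has a first translate strictly to the right of a, and finitely many e leave a
  common gap. The point a itself may be a translate.\<close>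

lemma finite_mod_1_gap:
  fixes E :: "real set"
  assumes "finite E"
  shows "\<exists>\<epsilon>>0. \<forall>e\<in>E. \<forall>l::int. \<not> (a < e + of_int l \<and> e + of_int l < a + \<epsilon>)"
proof -
  have "\<exists>\<epsilon>>0. \<forall>e\<in>E. a + \<epsilon> \<le> e + of_int (\<lfloor>a - e\<rfloor> + 1)"
  proof (rule finite_common_radius[OF assms])
    show "\<exists>\<epsilon>>0. a + \<epsilon> \<le> e + of_int (\<lfloor>a - e\<rfloor> + 1)" for e
      by (intro exI[of _ "e + of_int (\<lfloor>a - e\<rfloor> + 1) - a"]) (simp; linarith)
  qed simp
  then obtain \<epsilon> where \<epsilon>: "\<epsilon> > 0" "\<And>e. e \<in> E \<Longrightarrow> a + \<epsilon> \<le> e + of_int (\<lfloor>a - e\<rfloor> + 1)" by blast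
  have "\<not> (a < e + of_int l \<and> e + of_int l < a + \<epsilon>)" if "e \<in> E" for e and l :: int
  proof
    assume l: "a < e + of_int l \<and> e + of_int l < a + \<epsilon>"
    then have "\<lfloor>a - e\<rfloor> < l" by linarith
    then have "real_of_int (\<lfloor>a - e\<rfloor> + 1) \<le> of_int l" by linarith
    then show False using \<epsilon>(2)[OF that] l by linarith
  qed
  then show ?thesis using \<epsilon>(1) by blast
qed

context beatty
begin

lemma rotation_dense_mod:
  assumes "a < b" and "m > 0"
  obtains z k :: int where "a < of_int z * \<theta> - of_int k" "of_int z * \<theta> - of_int k < b" "z mod m = c mod m"
proof -
  obtain v where v: "a < v" "v < b" "cong_lat m (of_int c * \<theta>) v"
    using cong_lat_dense[OF assms] by blast
  then obtain x y where "v = of_int c * \<theta> + of_int m * (of_int x * \<theta> - of_int y)"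
    unfolding cong_lat_def by blast
  then have "v = of_int (c + m * x) * \<theta> - of_int (m * y)" by (simp add: algebra_simps)
  then show ?thesis using v by (intro that[of "c + m * x" "m * y"]) auto
qed

lemma rotation_dense:
  assumes "a < b"
  obtains z k :: int where "a < of_int z * \<theta> - of_int k" "of_int z * \<theta> - of_int k < b"
  using rotation_dense_mod[OF assms zero_less_one] by metis

end

text \<open>A 1-periodic step function whose jumps lie in E + Z. The half-open interval in
  \<open>step\<close> makes it continuous from the right; points of E may fail to be jumps.\<close>

locale step_fun = beatty +
  fixes s :: "real \<Rightarrow> bool" and E :: "real set"
  assumes finE: "finite E"
    and period1: "s (x + 1) = s x"
    and step: "a \<le> b \<Longrightarrow> (\<And>e k::int. e \<in> E \<Longrightarrow> \<not> (a < e + of_int k \<and> e + of_int k \<le> b)) \<Longrightarrow> s a = s b"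
    and nonconst: "\<exists>t1 t2. s t1 \<noteq> s t2"
begin

lemma periodN: "s (x + of_nat n) = s x"
proof (induction n)
  case (Suc n)
  have "s (x + of_nat (Suc n)) = s (x + of_nat n + 1)" by (simp add: algebra_simps)
  then show ?case using period1 Suc by simp
qed simp

lemma periodZ: "s (x + of_int k) = s x"
proof (cases k)
  case (nonneg n)
  then show ?thesis using periodN by simp
next
  case (neg n)
  then show ?thesis using periodN[of "x + of_int k" "Suc n"] by simp
qed

lemma periodZ': "s (x - of_int k) = s x"
  using periodZ[of x "- k"] by simp

lemma right_constant: "\<exists>\<epsilon>>0. \<forall>u. a \<le> u \<and> u < a + \<epsilon> \<longrightarrow> s u = s a"
proof -
  obtain \<epsilon> where \<epsilon>: "\<epsilon> > 0" "\<forall>e\<in>E. \<forall>l::int. \<not> (a < e + of_int l \<and> e + of_int l < a + \<epsilon>)"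
    using finite_mod_1_gap[OF finE] by blast
  have "s u = s a" if u: "a \<le> u" "u < a + \<epsilon>" for u
    by (rule step[symmetric, OF u(1)]) (use \<epsilon>(2) u(2) in \<open>meson le_less_trans\<close>)
  then show ?thesis using \<epsilon>(1) by blast
qed

text \<open>Take the infimum of the points after t1 with a value other than \<open>s t1\<close>.
  Right continuity shows that the value has already changed at the infimum.\<close>

lemma jump: "\<exists>p \<eta>. \<eta> > 0 \<and> (\<forall>u. p - \<eta> \<le> u \<and> u < p \<longrightarrow> s u \<noteq> s p) \<and> (\<forall>u. p \<le> u \<and> u \<le> p + \<eta> \<longrightarrow> s u = s p)"
proof -
  obtain t1 t2 where t: "s t1 \<noteq> s t2" using nonconst by blast
  define A where "A = {t. t1 \<le> t \<and> s t \<noteq> s t1}"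
  have "t1 \<le> t2 + of_int \<lceil>t1 - t2\<rceil>" by linarith
  then have "t2 + of_int \<lceil>t1 - t2\<rceil> \<in> A"
    using t periodZ[of t2] unfolding A_def by auto
  then have ne: "A \<noteq> {}" by blast
  have bdd: "bdd_below A" by (rule bdd_belowI[of _ t1]) (simp add: A_def)
  define p where "p = Inf A"
  have before: "s u = s t1" if "t1 \<le> u" "u < p" for u
    using cInf_lower[OF _ bdd, of u] that by (force simp: A_def p_def)
  have "t1 \<le> p" unfolding p_def using ne by (rule cInf_greatest) (simp add: A_def)
  obtain \<epsilon> where \<epsilon>: "\<epsilon> > 0" "\<And>u. p \<le> u \<Longrightarrow> u < p + \<epsilon> \<Longrightarrow> s u = s p" using right_constant by blast
  have sp: "s p \<noteq> s t1"
  proof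
    assume eq: "s p = s t1"
    have "p + \<epsilon> \<le> t" if "t \<in> A" for t
    proof (rule ccontr)
      assume "\<not> p + \<epsilon> \<le> t"
      moreover have "p \<le> t" unfolding p_def using that bdd by (rule cInf_lower)
      ultimately have "s t = s t1" using \<epsilon>(2) eq by simp
      then show False using that by (simp add: A_def)
    qed
    with ne have "p + \<epsilon> \<le> p" unfolding p_def by (rule cInf_greatest)
    then show False using \<epsilon>(1) by simp
  qed
  then have "t1 < p" using \<open>t1 \<le> p\<close> by (cases "t1 = p") auto
  define d where "d = min (\<epsilon> / 2) (p - t1)"
  have d: "d > 0" "d < \<epsilon>" "t1 \<le> p - d" using \<epsilon>(1) \<open>t1 < p\<close> unfolding d_def by linarith+
  have "s u \<noteq> s p" if "p - d \<le> u" "u < p" for u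
    using before[of u] that d sp by simp
  moreover have "s u = s p" if "p \<le> u" "u \<le> p + d" for u
    using \<epsilon>(2)[of u] that d by simp
  ultimately show ?thesis using d(1) by blast
qed

section \<open>The group of periods\<close>

definition periods :: "real set" where
  "periods = {\<delta>. \<forall>x. s (x + \<delta>) = s x}"

lemma periodsD: "\<delta> \<in> periods \<Longrightarrow> s (x + \<delta>) = s x"
  by (simp add: periods_def)

lemma periods_int: "of_int k \<in> periods"
  by (simp add: periods_def periodZ)

lemma periods_diff: "\<delta> \<in> periods \<Longrightarrow> \<gamma> \<in> periods \<Longrightarrow> \<delta> - \<gamma> \<in> periods"
proof -
  assume "\<delta> \<in> periods" "\<gamma> \<in> periods"
  then have "s (x + (\<delta> - \<gamma>)) = s x" for x
    using periodsD[of \<gamma> "x + (\<delta> - \<gamma>)"] periodsD[of \<delta> x] by simp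
  then show ?thesis by (simp add: periods_def)
qed

lemma periods_uminus: "\<delta> \<in> periods \<Longrightarrow> - \<delta> \<in> periods"
  using periods_diff[OF periods_int[of 0], of \<delta>] by simp

lemma periods_add: "\<delta> \<in> periods \<Longrightarrow> \<gamma> \<in> periods \<Longrightarrow> \<delta> + \<gamma> \<in> periods"
  using periods_diff[OF _ periods_uminus, of \<delta> \<gamma>] by simp

lemma periods_scale: 
  assumes "\<delta> \<in> periods" 
  shows "of_int k * \<delta> \<in> periods"
proof (induction k rule: int_induct[of _ 0])
  case base
  then show ?case using periods_int[of 0] by simp
next
  case (step1 i)
  then show ?case using periods_add[OF step1(2) assms] by (simp add: algebra_simps)
next
  case (step2 i)
  then show ?case using periods_diff[OF step2(2) assms] by (simp add: algebra_simps)
qed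

definition p :: real where
  "p = (SOME p. \<exists>\<eta>>0. (\<forall>u. p - \<eta> \<le> u \<and> u < p \<longrightarrow> s u \<noteq> s p) \<and> (\<forall>u. p \<le> u \<and> u \<le> p + \<eta> \<longrightarrow> s u = s p))"

definition \<eta> :: real where
  "\<eta> = (SOME \<eta>. \<eta> > 0 \<and> (\<forall>u. p - \<eta> \<le> u \<and> u < p \<longrightarrow> s u \<noteq> s p) \<and> (\<forall>u. p \<le> u \<and> u \<le> p + \<eta> \<longrightarrow> s u = s p))"

lemma jump_p: "\<eta> > 0" "p - \<eta> \<le> u \<Longrightarrow> u < p \<Longrightarrow> s u \<noteq> s p" "p \<le> u \<Longrightarrow> u \<le> p + \<eta> \<Longrightarrow> s u = s p"
proof -
  have "\<exists>p. \<exists>\<eta>>0. (\<forall>u. p - \<eta> \<le> u \<and> u < p \<longrightarrow> s u \<noteq> s p) \<and> (\<forall>u. p \<le> u \<and> u \<le> p + \<eta> \<longrightarrow> s u = s p)"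
    using jump by blast
  from someI_ex[OF this, folded p_def] have "\<exists>\<eta>. \<eta> > 0 \<and> (\<forall>u. p - \<eta> \<le> u \<and> u < p \<longrightarrow> s u \<noteq> s p)
     \<and> (\<forall>u. p \<le> u \<and> u \<le> p + \<eta> \<longrightarrow> s u = s p)" by blast
  from someI_ex[OF this, folded \<eta>_def]
  show "\<eta> > 0" "p - \<eta> \<le> u \<Longrightarrow> u < p \<Longrightarrow> s u \<noteq> s p" "p \<le> u \<Longrightarrow> u \<le> p + \<eta> \<Longrightarrow> s u = s p"
    by blast+
qed

text \<open>A small nonzero period, taken negative, would carry \<open>p\<close> to a point just
  left of it, where the value is different.\<close>

lemma periods_discrete:
  assumes "\<delta> \<in> periods" "\<bar>\<delta>\<bar> \<le> \<eta>"
  shows "\<delta> = 0"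
proof (rule ccontr)
  assume "\<delta> \<noteq> 0"
  have "- \<bar>\<delta>\<bar> \<in> periods" using assms(1) periods_uminus by (auto simp: abs_if)
  from periodsD[OF this, of p] jump_p(2)[of "p - \<bar>\<delta>\<bar>"] assms(2) \<open>\<delta> \<noteq> 0\<close> show False by simp
qed

lemma periods_cyclic: "\<exists>m::int. m > 0 \<and> (\<forall>\<delta>. \<delta> \<in> periods \<longleftrightarrow> (\<exists>i::int. of_int m * \<delta> = of_int i))"
proof -
  \<comment> \<open>A least positive period is found by minimising over cells of length \<eta>: two
    periods in the same cell differ by less than \<eta> and coincide by discreteness.\<close>
  have "\<exists>\<delta>. (\<delta> \<in> periods \<and> 0 < \<delta>) \<and> (\<forall>\<gamma>. (\<gamma> \<in> periods \<and> 0 < \<gamma>) \<longrightarrow> nat \<lfloor>\<delta> / \<eta>\<rfloor> \<le> nat \<lfloor>\<gamma> / \<eta>\<rfloor>)"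
    using periods_int[of 1] by (intro ex_has_least_nat[of _ 1]) auto
  then obtain T where T: "T \<in> periods" "0 < T"
    and least: "\<And>\<gamma>. \<gamma> \<in> periods \<Longrightarrow> 0 < \<gamma> \<Longrightarrow> nat \<lfloor>T / \<eta>\<rfloor> \<le> nat \<lfloor>\<gamma> / \<eta>\<rfloor>" by blast
  have min: "\<not> (0 < \<gamma> \<and> \<gamma> < T)" if "\<gamma> \<in> periods" for \<gamma>
  proof
    assume \<gamma>: "0 < \<gamma> \<and> \<gamma> < T"
    have pos: "0 \<le> \<gamma> / \<eta>" "0 \<le> T / \<eta>" "\<gamma> / \<eta> < T / \<eta>"
      using \<gamma> T(2) jump_p(1) by (auto simp: divide_strict_right_mono)
    then have "\<lfloor>T / \<eta>\<rfloor> \<le> \<lfloor>\<gamma> / \<eta>\<rfloor>" using least[OF that] \<gamma> by (simp add: nat_le_iff)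
    then have "T / \<eta> - \<gamma> / \<eta> < 1" using pos by linarith
    then have "T - \<gamma> \<le> \<eta>" using jump_p(1) by (simp add: field_simps)
    then show False using periods_discrete[OF periods_diff[OF T(1) that]] \<gamma> by simp
  qed
  have mult: "\<exists>n::int. \<delta> = of_int n * T" if "\<delta> \<in> periods" for \<delta>
  proof -
    define \<gamma> where "\<gamma> = \<delta> - of_int \<lfloor>\<delta> / T\<rfloor> * T"
    have "\<gamma> \<in> periods" unfolding \<gamma>_def by (intro periods_diff periods_scale that T)
    moreover have "\<gamma> = frac (\<delta> / T) * T" using T(2) by (simp add: \<gamma>_def frac_def field_simps)
    then have "0 \<le> \<gamma>" "\<gamma> < T" using T(2) frac_lt_1[of "\<delta> / T"] by auto
    ultimately have "\<gamma> = 0" using min[of \<gamma>] by force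
    then show ?thesis unfolding \<gamma>_def by (intro exI[of _ "\<lfloor>\<delta> / T\<rfloor>"]) simp
  qed
  obtain m :: int where m: "1 = of_int m * T" using mult[OF periods_int[of 1]] by auto
  then have "0 < of_int m * T" by simp
  then have m0: "m > 0" using T(2) by (simp add: zero_less_mult_iff)
  have "\<delta> \<in> periods \<longleftrightarrow> (\<exists>i::int. of_int m * \<delta> = of_int i)" for \<delta>
  proof
    assume "\<delta> \<in> periods"
    then obtain n :: int where "\<delta> = of_int n * T" using mult by blast
    then have "of_int m * \<delta> = of_int n * (of_int m * T)" by simp
    then show "\<exists>i::int. of_int m * \<delta> = of_int i" using m by auto
  next
    assume "\<exists>i::int. of_int m * \<delta> = of_int i"
    then obtain i :: int where i: "of_int m * \<delta> = of_int i" by blast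
    have "\<delta> = (of_int m * T) * \<delta>" using m by simp
    also have "\<dots> = of_int i * T" using i by (simp add: mult_ac)
    finally show "\<delta> \<in> periods" using periods_scale[OF T(1)] by simp
  qed
  then show ?thesis using m0 by blast
qed

text \<open>Some t has different values at t and t + \<delta>. Both values persist a little to the
  right, and density puts a multiple b \<theta> modulo 1 there, so the difference is witnessed at an
  element of the group.\<close>

lemma separate_nonperiod:
  assumes "\<delta> \<notin> periods"
  shows "\<exists>b::int. \<exists>\<epsilon>>0. (\<forall>x. \<bar>x - \<delta>\<bar> < \<epsilon> \<longrightarrow> s (of_int b * \<theta> + x) \<noteq> s (of_int b * \<theta>)) \<and>
     (\<forall>x. \<bar>x\<bar> < \<epsilon> \<longrightarrow> s (of_int b * \<theta> + x) = s (of_int b * \<theta>))"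
proof -
  obtain t where t: "s (t + \<delta>) \<noteq> s t" using assms by (auto simp: periods_def)
  obtain \<epsilon>1 where \<epsilon>1: "\<epsilon>1 > 0" "\<And>u. t \<le> u \<Longrightarrow> u < t + \<epsilon>1 \<Longrightarrow> s u = s t" using right_constant by blast
  obtain \<epsilon>2 where \<epsilon>2: "\<epsilon>2 > 0" "\<And>u. t + \<delta> \<le> u \<Longrightarrow> u < t + \<delta> + \<epsilon>2 \<Longrightarrow> s u = s (t + \<delta>)"
    using right_constant by blast
  define \<epsilon> where "\<epsilon> = min \<epsilon>1 \<epsilon>2 / 3"
  have \<epsilon>: "\<epsilon> > 0" "3 * \<epsilon> \<le> \<epsilon>1" "3 * \<epsilon> \<le> \<epsilon>2" using \<epsilon>1(1) \<epsilon>2(1) by (auto simp: \<epsilon>_def)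
  obtain b k :: int where b: "t + \<epsilon> < of_int b * \<theta> - of_int k" "of_int b * \<theta> - of_int k < t + 2 * \<epsilon>"
    using rotation_dense[of "t + \<epsilon>" "t + 2 * \<epsilon>"] \<epsilon>(1) by auto
  have shift: "s (of_int b * \<theta> + x) = s (of_int b * \<theta> - of_int k + x)" for x
    using periodZ'[of "of_int b * \<theta> + x" k] by (simp add: algebra_simps)
  have st: "s (of_int b * \<theta> + x) = s t" if "\<bar>x\<bar> < \<epsilon>" for x
    unfolding shift using that b \<epsilon> by (intro \<epsilon>1(2)) (auto simp: abs_if split: if_splits)
  have "s (of_int b * \<theta> + x) = s (t + \<delta>)" if "\<bar>x - \<delta>\<bar> < \<epsilon>" for x
    unfolding shift using that b \<epsilon> by (intro \<epsilon>2(2)) (auto simp: abs_if split: if_splits)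
  then show ?thesis using t st st[of 0] \<epsilon>(1) by (intro exI[of _ b] exI[of _ \<epsilon>]) auto
qed

section \<open>Definable neighbourhoods of the periods\<close>

text \<open>Testing at multiples of \<theta> keeps the condition expressible in the group when
  \<open>A\<close> is finite.\<close>

definition agree :: "int set \<Rightarrow> real \<Rightarrow> bool" where
  "agree A x \<longleftrightarrow> (\<forall>b\<in>A. s (of_int b * \<theta> + x) = s (of_int b * \<theta>))"

lemma agree_period: "\<delta> \<in> periods \<Longrightarrow> agree A (x + \<delta>) = agree A x"
  using periodsD[of \<delta>] unfolding agree_def by (metis add.assoc)

text \<open>A shift \<open>x\<close> which agrees with \<open>s\<close> on two points close to \<open>p\<close> on either side moves \<open>p\<close> close to a
  jump. Only finitely many jumps exist modulo 1, so finitely many further points exclude the ones that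
  are not reached from \<open>p\<close> by a period.\<close>

lemma agree_near_periods:
  assumes "\<eta>' > 0"
  shows "\<exists>A \<kappa>. finite A \<and> \<kappa> > 0 \<and> (\<forall>x. \<bar>x\<bar> < \<kappa> \<longrightarrow> agree A x) \<and>
    (\<forall>x. agree A x \<longrightarrow> (\<exists>\<delta>\<in>periods. \<bar>x - \<delta>\<bar> < \<eta>'))"
proof -
  \<comment> \<open>Shifts that carry \<open>p\<close> to a candidate jump without being periods;
    each is excluded by a test point of its own.\<close>
  define D where "D = {e - p | e. e \<in> E \<and> e - p \<notin> periods}"
  have finD: "finite D"
    using finE by (auto intro: finite_subset[of _ "(\<lambda>e. e - p) ` E"] simp: D_def)
  have "\<forall>\<delta>\<in>D. \<exists>b::int. \<exists>\<epsilon>>0. (\<forall>x. \<bar>x - \<delta>\<bar> < \<epsilon> \<longrightarrow> s (of_int b * \<theta> + x) \<noteq> s (of_int b * \<theta>)) \<and>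
     (\<forall>x. \<bar>x\<bar> < \<epsilon> \<longrightarrow> s (of_int b * \<theta> + x) = s (of_int b * \<theta>))"
    using separate_nonperiod by (auto simp: D_def)
  then obtain b :: "real \<Rightarrow> int" where b: "\<forall>\<delta>\<in>D. \<exists>\<epsilon>>0. (\<forall>x. \<bar>x - \<delta>\<bar> < \<epsilon> \<longrightarrow>
      s (of_int (b \<delta>) * \<theta> + x) \<noteq> s (of_int (b \<delta>) * \<theta>)) \<and>
     (\<forall>x. \<bar>x\<bar> < \<epsilon> \<longrightarrow> s (of_int (b \<delta>) * \<theta> + x) = s (of_int (b \<delta>) * \<theta>))" by metis
  have "\<exists>\<epsilon>>0. \<forall>\<delta>\<in>D. (\<forall>x. \<bar>x - \<delta>\<bar> < \<epsilon> \<longrightarrow> s (of_int (b \<delta>) * \<theta> + x) \<noteq> s (of_int (b \<delta>) * \<theta>)) \<and>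
     (\<forall>x. \<bar>x\<bar> < \<epsilon> \<longrightarrow> s (of_int (b \<delta>) * \<theta> + x) = s (of_int (b \<delta>) * \<theta>))"
    by (rule finite_common_radius[OF finD]) (use b in auto)
  then obtain \<epsilon>0 where \<epsilon>0: "\<epsilon>0 > 0"
    and far: "\<And>\<delta> x. \<delta> \<in> D \<Longrightarrow> \<bar>x - \<delta>\<bar> < \<epsilon>0 \<Longrightarrow> s (of_int (b \<delta>) * \<theta> + x) \<noteq> s (of_int (b \<delta>) * \<theta>)"
    and near: "\<And>\<delta> x. \<delta> \<in> D \<Longrightarrow> \<bar>x\<bar> < \<epsilon>0 \<Longrightarrow> s (of_int (b \<delta>) * \<theta> + x) = s (of_int (b \<delta>) * \<theta>)" by blast
  define \<epsilon> where "\<epsilon> = min \<epsilon>0 (min \<eta>' \<eta>)"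
  have \<epsilon>: "\<epsilon> > 0" "\<epsilon> \<le> \<epsilon>0" "\<epsilon> \<le> \<eta>'" "\<epsilon> \<le> \<eta>" using \<epsilon>0 assms jump_p(1) by (auto simp: \<epsilon>_def)
  obtain b0 k0 :: int where b0: "p - \<epsilon> / 2 < of_int b0 * \<theta> - of_int k0" "of_int b0 * \<theta> - of_int k0 < p"
    using rotation_dense[of "p - \<epsilon> / 2" p] \<epsilon>(1) by auto
  obtain b1 k1 :: int where b1: "p < of_int b1 * \<theta> - of_int k1" "of_int b1 * \<theta> - of_int k1 < p + \<epsilon> / 2"
    using rotation_dense[of p "p + \<epsilon> / 2"] \<epsilon>(1) by auto
  have shift: "s (of_int b * \<theta> + x) = s (of_int b * \<theta> - of_int k + x)" for b k x
    using periodZ'[of "of_int b * \<theta> + x" k] by (simp add: algebra_simps)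
  \<comment> \<open>Shifts smaller than \<kappa> keep both test points on their own side of
    \<open>p\<close> and leave the other tests unaffected.\<close>
  define \<kappa> where "\<kappa> = min \<epsilon>0 (min (\<epsilon> / 2) (min (p - (of_int b0 * \<theta> - of_int k0)) (of_int b1 * \<theta> - of_int k1 - p)))"
  have "\<kappa> > 0" using \<epsilon>0 \<epsilon> b0 b1 by (simp add: \<kappa>_def)
  moreover have "\<kappa> \<le> \<epsilon>0" "\<kappa> \<le> \<epsilon> / 2" "\<kappa> \<le> p - (of_int b0 * \<theta> - of_int k0)"
    "\<kappa> \<le> of_int b1 * \<theta> - of_int k1 - p"
    unfolding \<kappa>_def by linarith+
  ultimately have \<kappa>: "\<kappa> > 0" "\<kappa> \<le> \<epsilon>0" "\<kappa> \<le> \<epsilon> / 2" "\<kappa> \<le> p - (of_int b0 * \<theta> - of_int k0)"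
    "\<kappa> \<le> of_int b1 * \<theta> - of_int k1 - p" by blast+
  define A where "A = {b0, b1} \<union> b ` D"
  have b0s: "s (of_int b0 * \<theta> + x) \<noteq> s p" if "\<bar>x\<bar> < \<kappa>" for x
    unfolding shift[of b0 x k0] using that \<kappa> b0 \<epsilon> by (intro jump_p(2)) (auto simp: abs_if split: if_splits)
  have b1s: "s (of_int b1 * \<theta> + x) = s p" if "\<bar>x\<bar> < \<kappa>" for x
    unfolding shift[of b1 x k1] using that \<kappa> b1 \<epsilon> by (intro jump_p(3)) (auto simp: abs_if split: if_splits)
  have "agree A x" if "\<bar>x\<bar> < \<kappa>" for x
    using b0s[OF that] b0s[of 0] b1s[OF that] b1s[of 0] near[of _ x] that \<kappa>
    by (auto simp: agree_def A_def)
  moreover have "\<exists>\<delta>\<in>periods. \<bar>x - \<delta>\<bar> < \<eta>'" if x: "agree A x" for x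
  proof -
    have "s (of_int b0 * \<theta> + x) \<noteq> s (of_int b1 * \<theta> + x)"
      using x b0s[of 0] b1s[of 0] \<kappa>(1) by (simp add: agree_def A_def)
    then have "s (of_int b0 * \<theta> - of_int k0 + x) \<noteq> s (of_int b1 * \<theta> - of_int k1 + x)"
      using shift by metis
    moreover have "of_int b0 * \<theta> - of_int k0 + x \<le> of_int b1 * \<theta> - of_int k1 + x" using b0 b1 by simp
    ultimately obtain e and k :: int where e: "e \<in> E" "of_int b0 * \<theta> - of_int k0 + x < e + of_int k"
       "e + of_int k \<le> of_int b1 * \<theta> - of_int k1 + x"
      using step by blast
    have d: "\<bar>x - of_int k - (e - p)\<bar> < \<epsilon>"
      using e b0 b1 by (simp add: abs_if)
    have "e - p \<in> periods"
    proof (rule ccontr)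
      assume "e - p \<notin> periods"
      then have D: "e - p \<in> D" using e by (auto simp: D_def)
      have "s (of_int (b (e - p)) * \<theta> + (x - of_int k)) \<noteq> s (of_int (b (e - p)) * \<theta>)"
        using d \<epsilon> by (intro far[OF D]) simp
      moreover have "agree A (x - of_int k)"
        using x agree_period[OF periods_int[of "- k"], of A x] by simp
      ultimately show False using D by (auto simp: agree_def A_def)
    qed
    then have "e - p + of_int k \<in> periods" by (intro periods_add periods_int)
    moreover have "\<bar>x - (e - p + of_int k)\<bar> < \<eta>'" using d \<epsilon> by (simp add: algebra_simps)
    ultimately show ?thesis by blast
  qed
  moreover have "finite A" using finD by (simp add: A_def)
  ultimately show ?thesis using \<kappa>(1) by blast
qed

text \<open>Near \<open>p\<close>, the points with value \<open>s p\<close> are those from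
  \<open>p\<close> on, so the small shifts preserving this set locally go to the right. Two such
  one-sided conditions, for x and for b - x, cut out a closed arc modulo the periods.\<close>

lemma arcs_mod_periods_definable:
  assumes s: "(\<lambda>w. s (of_int (w 0) * \<theta>)) \<in> dfn B"
  shows "\<exists>\<kappa>>0. \<forall>b k::int. 0 < of_int b * \<theta> - of_int k \<and> of_int b * \<theta> - of_int k < \<kappa> \<longrightarrow>
    (\<lambda>w. \<exists>\<delta>\<in>periods. 0 \<le> of_int (w 0) * \<theta> - \<delta> \<and> of_int (w 0) * \<theta> - \<delta> \<le> of_int b * \<theta> - of_int k) \<in> dfn B"
proof -
  have "\<eta> / 4 > 0" using jump_p(1) by simp
  from agree_near_periods[OF this] obtain A \<kappa>0 where A: "finite A" "\<kappa>0 > 0"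
    and small0: "\<And>x. \<bar>x\<bar> < \<kappa>0 \<Longrightarrow> agree A x" and big: "\<And>x. agree A x \<Longrightarrow> \<exists>\<delta>\<in>periods. \<bar>x - \<delta>\<bar> < \<eta> / 4"
    by blast
  define \<kappa> where "\<kappa> = min \<kappa>0 (\<eta> / 4)"
  have \<kappa>: "\<kappa> > 0" "\<kappa> \<le> \<eta> / 4" using A jump_p(1) by (auto simp: \<kappa>_def)
  have small: "agree A x" if "\<bar>x\<bar> < \<kappa>" for x using small0 that by (simp add: \<kappa>_def)
  \<comment> \<open>\<open>p\<close> itself need not be a multiple of \<theta> modulo 1; the nearby
    c \<theta> replaces it in the definition of \<open>up\<close>.\<close>
  obtain c k1 :: int where c: "p < of_int c * \<theta> - of_int k1" "of_int c * \<theta> - of_int k1 < p + \<kappa> / 2"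
    using rotation_dense[of p "p + \<kappa> / 2"] \<kappa>(1) by auto
  define up :: "int \<Rightarrow> bool" where "up x \<longleftrightarrow> agree A (of_int x * \<theta>) \<and>
      (\<forall>y. agree A (of_int (y - c) * \<theta>) \<and> s (of_int y * \<theta>) = s p \<longrightarrow> s (of_int (y + x) * \<theta>) = s p)" for x
  have upI: "up x" if \<delta>: "\<delta> \<in> periods" and x: "0 \<le> of_int x * \<theta> - \<delta>" "of_int x * \<theta> - \<delta> < \<kappa>" for x \<delta>
    unfolding up_def
  proof (intro conjI allI impI)
    show "agree A (of_int x * \<theta>)"
      using agree_period[OF \<delta>, of A "of_int x * \<theta> - \<delta>"] small[of "of_int x * \<theta> - \<delta>"] x by simp
    fix y assume y: "agree A (of_int (y - c) * \<theta>) \<and> s (of_int y * \<theta>) = s p"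
    then obtain \<gamma> where \<gamma>: "\<gamma> \<in> periods" "\<bar>of_int (y - c) * \<theta> - \<gamma>\<bar> < \<eta> / 4" using big by blast
    define Y where "Y = of_int y * \<theta> - \<gamma> - of_int k1"
    have Y: "p - \<eta> < Y" "Y < p + \<eta> / 2"
      using \<gamma>(2) c \<kappa> unfolding Y_def by (auto simp: abs_if algebra_simps split: if_splits)
    have "\<gamma> + of_int k1 \<in> periods" using \<gamma>(1) by (intro periods_add periods_int)
    from periodsD[OF this, of Y] have "s Y = s p" using y by (simp add: Y_def)
    then have "p \<le> Y" using jump_p(2)[of Y] Y by force
    then have "s (Y + (of_int x * \<theta> - \<delta>)) = s p" using Y x \<kappa> by (intro jump_p(3)) auto
    moreover have "\<gamma> + of_int k1 + \<delta> \<in> periods" using \<gamma>(1) \<delta> by (intro periods_add periods_int)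
    from periodsD[OF this, of "Y + (of_int x * \<theta> - \<delta>)"]
    have "s (of_int (y + x) * \<theta>) = s (Y + (of_int x * \<theta> - \<delta>))" by (simp add: Y_def algebra_simps)
    ultimately show "s (of_int (y + x) * \<theta>) = s p" by simp
  qed
  have upD: "\<exists>\<delta>\<in>periods. 0 \<le> of_int x * \<theta> - \<delta> \<and> of_int x * \<theta> - \<delta> < \<eta> / 4" if up: "up x" for x
  proof -
    obtain \<delta> where \<delta>: "\<delta> \<in> periods" "\<bar>of_int x * \<theta> - \<delta>\<bar> < \<eta> / 4"
      using up big unfolding up_def by blast
    define x0 where "x0 = of_int x * \<theta> - \<delta>"
    have "0 \<le> x0"
    proof (rule ccontr)
      assume neg: "\<not> 0 \<le> x0"
      \<comment> \<open>A point right of \<open>p\<close>, at distance less than -x0, is carried by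
        the negative shift x0 to the left of \<open>p\<close>, where the value is different.\<close>
      then obtain y k :: int where y: "p < of_int y * \<theta> - of_int k"
         "of_int y * \<theta> - of_int k < p + min (- x0) (\<kappa> / 2)"
        using rotation_dense[of p "p + min (- x0) (\<kappa> / 2)"] \<kappa>(1) by auto
      have "agree A (of_int (y - c) * \<theta> + of_int (k1 - k))"
        using y c by (intro small) (auto simp: abs_if algebra_simps)
      then have "agree A (of_int (y - c) * \<theta>)"
        using agree_period[OF periods_int] by blast
      moreover have "s (of_int y * \<theta> - of_int k) = s p" using y \<kappa> jump_p(1) by (intro jump_p(3)) auto
      then have "s (of_int y * \<theta>) = s p" using periodZ' by blast
      ultimately have "s (of_int (y + x) * \<theta>) = s p" using up unfolding up_def by blast
      moreover have "s (of_int y * \<theta> - of_int k + x0) \<noteq> s p"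
        using y \<delta> neg unfolding x0_def by (intro jump_p(2)) (auto simp: abs_if split: if_splits)
      moreover have "of_int k + \<delta> \<in> periods" using \<delta>(1) by (intro periods_add periods_int)
      from periodsD[OF this, of "of_int y * \<theta> - of_int k + x0"]
      have "s (of_int (y + x) * \<theta>) = s (of_int y * \<theta> - of_int k + x0)" by (simp add: x0_def algebra_simps)
      ultimately show False by simp
    qed
    then show ?thesis using \<delta> unfolding x0_def by (intro bexI[of _ \<delta>]) auto
  qed
  have s': "(\<lambda>w. s (of_int (g w) * \<theta>) = v) \<in> dfn B" if "aff g" for g v
    using dfn_subst_unary[OF s that] by (rule dfn_iff_triv)
  have ag: "(\<lambda>w. agree A (of_int (g w) * \<theta>)) \<in> dfn B" if "aff g" for g
  proof -
    have "(\<lambda>w. \<forall>b\<in>A. s (of_int (b + g w) * \<theta>) = s (of_int b * \<theta>)) \<in> dfn B"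
      by (intro dfn_Ball A(1) s' aff_add aff_const that)
    then show ?thesis by (simp add: agree_def algebra_simps)
  qed
  have up0: "(\<lambda>w. up (w 0)) \<in> dfn B"
  proof -
    have "(\<lambda>w. agree A (of_int (w 1 - c) * \<theta>) \<and> s (of_int (w 1) * \<theta>) = s p \<longrightarrow> s (of_int (w 1 + w 0) * \<theta>) = s p) \<in> dfn B"
      by (intro dfn_imp conj ag s' aff_diff aff_add aff_const aff_var)
    from conj[OF ag[OF aff_var[of 0]] dfn_all[OF this, of 1]] show ?thesis
      by (simp add: up_def)
  qed
  have "(\<lambda>w. \<exists>\<delta>\<in>periods. 0 \<le> of_int (w 0) * \<theta> - \<delta> \<and> of_int (w 0) * \<theta> - \<delta> \<le> of_int b * \<theta> - of_int k) \<in> dfn B"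
    if b: "0 < of_int b * \<theta> - of_int k" "of_int b * \<theta> - of_int k < \<kappa>" for b k :: int
  proof -
    define \<beta> where "\<beta> = of_int b * \<theta> - of_int k"
    have "(\<lambda>w. up (w 0) \<and> up (b - w 0)) \<in> dfn B"
      by (intro conj up0 dfn_subst_unary[OF up0] aff_diff aff_const aff_var)
    moreover have "up x \<and> up (b - x) \<longleftrightarrow> (\<exists>\<delta>\<in>periods. 0 \<le> of_int x * \<theta> - \<delta> \<and> of_int x * \<theta> - \<delta> \<le> \<beta>)" for x
    proof
      assume "up x \<and> up (b - x)"
      then obtain \<delta> \<gamma> where \<delta>: "\<delta> \<in> periods" "0 \<le> of_int x * \<theta> - \<delta>" "of_int x * \<theta> - \<delta> < \<eta> / 4"
        and \<gamma>: "\<gamma> \<in> periods" "0 \<le> of_int (b - x) * \<theta> - \<gamma>" "of_int (b - x) * \<theta> - \<gamma> < \<eta> / 4"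
        using upD by blast
      \<comment> \<open>This period has absolute value at most \<eta> and therefore vanishes, so the
        two one-sided conditions refer to matching periods.\<close>
      have "\<delta> + \<gamma> - of_int k \<in> periods" by (intro periods_diff periods_add periods_int \<delta> \<gamma>)
      moreover have sum: "\<delta> + \<gamma> - of_int k = \<beta> - (of_int x * \<theta> - \<delta>) - (of_int (b - x) * \<theta> - \<gamma>)"
        by (simp add: \<beta>_def algebra_simps)
      moreover have "\<bar>\<beta> - (of_int x * \<theta> - \<delta>) - (of_int (b - x) * \<theta> - \<gamma>)\<bar> \<le> \<eta>"
        using \<delta> \<gamma> b \<kappa> unfolding \<beta>_def[symmetric] by linarith
      ultimately have "\<delta> + \<gamma> - of_int k = 0" using periods_discrete by metis
      then have "of_int x * \<theta> - \<delta> \<le> \<beta>" using sum \<gamma>(2) by linarith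
      then show "\<exists>\<delta>\<in>periods. 0 \<le> of_int x * \<theta> - \<delta> \<and> of_int x * \<theta> - \<delta> \<le> \<beta>" using \<delta> by blast
    next
      assume "\<exists>\<delta>\<in>periods. 0 \<le> of_int x * \<theta> - \<delta> \<and> of_int x * \<theta> - \<delta> \<le> \<beta>"
      then obtain \<delta> where \<delta>: "\<delta> \<in> periods" "0 \<le> of_int x * \<theta> - \<delta>" "of_int x * \<theta> - \<delta> \<le> \<beta>" by blast
      have e: "of_int (b - x) * \<theta> - (of_int k - \<delta>) = \<beta> - (of_int x * \<theta> - \<delta>)"
        by (simp add: \<beta>_def algebra_simps)
      have "up x" using \<delta> b by (intro upI[OF \<delta>(1)]) (auto simp: \<beta>_def)
      moreover have k\<delta>: "of_int k - \<delta> \<in> periods" by (intro periods_diff periods_int \<delta>)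
      have "up (b - x)"
        by (rule upI[OF k\<delta>]; unfold e; use \<delta> b \<beta>_def in linarith)
      ultimately show "up x \<and> up (b - x)" ..
    qed
    ultimately show ?thesis by (simp add: \<beta>_def)
  qed
  then show ?thesis using \<kappa>(1) by blast
qed

section \<open>From arcs modulo the periods to the given arc\<close>

text \<open>The periods form (1/m) Z. Multiplication by m turns an arc modulo the periods into the
  multiples of m in an arc modulo 1, and translates bring in the other residue classes. The
  resulting arcs are too long; intersecting with a shorter arc modulo the periods trims
  them.\<close>

lemma arc_definable:
  assumes s: "(\<lambda>w. s (of_int (w 0) * \<theta>)) \<in> dfn B"
  shows "\<exists>b k::int. 0 < of_int b * \<theta> - of_int k \<and> of_int b * \<theta> - of_int k < \<theta> \<and>
    (\<lambda>w. \<exists>j::int. 0 \<le> of_int (w 0) * \<theta> - of_int j \<and> of_int (w 0) * \<theta> - of_int j \<le> of_int b * \<theta> - of_int k) \<in> dfn B"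
proof -
  define arc where "arc \<beta> x \<longleftrightarrow> (\<exists>\<delta>\<in>periods. 0 \<le> of_int x * \<theta> - \<delta> \<and> of_int x * \<theta> - \<delta> \<le> \<beta>)" for \<beta> :: real and x :: int
  obtain \<kappa> where \<kappa>: "\<kappa> > 0" and arcs: "\<And>b k::int. 0 < of_int b * \<theta> - of_int k \<Longrightarrow> of_int b * \<theta> - of_int k < \<kappa> \<Longrightarrow>
      (\<lambda>w. arc (of_int b * \<theta> - of_int k) (w 0)) \<in> dfn B"
    using arcs_mod_periods_definable[OF s] unfolding arc_def by blast
  obtain m :: int where m: "m > 0" and per: "\<And>\<delta>. \<delta> \<in> periods \<longleftrightarrow> (\<exists>i::int. of_int m * \<delta> = of_int i)"
    using periods_cyclic by blast
  have rm: "real_of_int m \<ge> 1" using m by linarith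
  \<comment> \<open>Small enough for definable arcs, for the bound \<theta> of the conclusion, and
    for m \<beta>1 to stay below half the spacing 1/m of the periods.\<close>
  define \<epsilon> where "\<epsilon> = min (min \<kappa> \<theta>) (1 / (2 * of_int m * of_int m))"
  have "\<epsilon> > 0" using \<kappa> theta m by (simp add: \<epsilon>_def)
  then obtain b1 k1 :: int where b1: "0 < of_int b1 * \<theta> - of_int k1" "of_int b1 * \<theta> - of_int k1 < \<epsilon>"
    using rotation_dense by metis
  define \<beta>1 where "\<beta>1 = of_int b1 * \<theta> - of_int k1"
  obtain b k :: int where b: "0 < of_int b * \<theta> - of_int k" "of_int b * \<theta> - of_int k < \<beta>1"
    using rotation_dense[of 0 \<beta>1] b1 unfolding \<beta>1_def by metis
  define \<beta> where "\<beta> = of_int b * \<theta> - of_int k"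
  have \<beta>: "0 < \<beta>" "\<beta> < \<beta>1" "\<beta>1 < \<kappa>" "\<beta>1 < \<theta>" "0 < \<beta>1" using b b1 by (auto simp: \<beta>_def \<beta>1_def \<epsilon>_def)
  have "\<beta>1 < 1 / (2 * of_int m * of_int m)" using b1(2) by (simp add: \<beta>1_def \<epsilon>_def)
  then have m\<beta>: "of_int m * \<beta>1 < 1 / (2 * of_int m)" using rm by (simp add: field_simps)
  have \<beta>1m: "\<beta>1 \<le> of_int m * \<beta>1" using rm \<beta>(5) by simp
  \<comment> \<open>The translate for class c starts before 0, but by less than \<beta>1 - \<beta>,
    so that it still covers all of [0, \<beta>].\<close>
  have "\<exists>e f::int. e mod m = c mod m \<and> - (\<beta>1 - \<beta>) < of_int e * \<theta> - of_int f \<and> of_int e * \<theta> - of_int f < 0" for c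
    using rotation_dense_mod[of "- (\<beta>1 - \<beta>)" 0 m c] \<beta> m by (metis diff_gt_0_iff_gt neg_less_0_iff_less)
  then obtain e f :: "int \<Rightarrow> int" where e: "\<And>c. e c mod m = c mod m"
    "\<And>c. - (\<beta>1 - \<beta>) < of_int (e c) * \<theta> - of_int (f c)" "\<And>c. of_int (e c) * \<theta> - of_int (f c) < 0"
    by metis
  define dil where "dil y \<longleftrightarrow> (\<exists>x. y = m * x \<and> arc \<beta>1 x)" for y
  have dil: "dil y \<longleftrightarrow> m dvd y \<and> (\<exists>j::int. 0 \<le> of_int y * \<theta> - of_int j \<and> of_int y * \<theta> - of_int j \<le> of_int m * \<beta>1)" for y
  proof
    assume "dil y"
    then obtain x \<delta> where x: "y = m * x" "\<delta> \<in> periods" "0 \<le> of_int x * \<theta> - \<delta>" "of_int x * \<theta> - \<delta> \<le> \<beta>1"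
      by (auto simp: dil_def arc_def)
    then obtain j :: int where j: "of_int m * \<delta> = of_int j" using per by blast
    have eq: "of_int y * \<theta> - of_int j = of_int m * (of_int x * \<theta> - \<delta>)" by (simp add: x(1) j[symmetric] algebra_simps)
    have "0 \<le> of_int y * \<theta> - of_int j" "of_int y * \<theta> - of_int j \<le> of_int m * \<beta>1"
      unfolding eq using x rm by (auto intro: mult_nonneg_nonneg mult_left_mono)
    then show "m dvd y \<and> (\<exists>j::int. 0 \<le> of_int y * \<theta> - of_int j \<and> of_int y * \<theta> - of_int j \<le> of_int m * \<beta>1)"
      using x(1) by auto
  next
    assume "m dvd y \<and> (\<exists>j::int. 0 \<le> of_int y * \<theta> - of_int j \<and> of_int y * \<theta> - of_int j \<le> of_int m * \<beta>1)"
    then obtain x and j :: int where x: "y = m * x" "0 \<le> of_int y * \<theta> - of_int j" "of_int y * \<theta> - of_int j \<le> of_int m * \<beta>1"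
      unfolding dvd_def by blast
    have eq: "of_int y * \<theta> - of_int j = of_int m * (of_int x * \<theta> - of_int j / of_int m)"
      using rm by (simp add: x(1) field_simps)
    have "0 \<le> of_int x * \<theta> - of_int j / of_int m" "of_int x * \<theta> - of_int j / of_int m \<le> \<beta>1"
      using x(2,3) rm unfolding eq by (auto simp: zero_le_mult_iff mult_le_cancel_left)
    moreover have "of_int j / of_int m \<in> periods" using per rm by auto
    ultimately show "dil y" using x(1) by (auto simp: dil_def arc_def)
  qed
  have arc1: "(\<lambda>w. arc \<beta>1 (w 0)) \<in> dfn B" and arc2: "(\<lambda>w. arc \<beta> (w 0)) \<in> dfn B"
    using arcs b b1 \<beta> by (auto simp: \<beta>_def \<beta>1_def)
  have dil_dfn: "(\<lambda>w. dil (w 0)) \<in> dfn B"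
  proof -
    have "(\<lambda>w. w 0 = m * w 1 \<and> arc \<beta>1 (w 1)) \<in> dfn B"
      by (intro conj dfn_eq dfn_subst_unary[OF arc1] aff_scale aff_var)
    from ex[OF this, of 1] show ?thesis by (simp add: dil_def)
  qed
  have "(\<lambda>w. arc \<beta> (w 0) \<and> (\<exists>c\<in>{0..<m}. dil (w 0 - e c))) \<in> dfn B"
    by (intro conj arc2 dfn_Bex dfn_subst_unary[OF dil_dfn] aff_diff aff_var aff_const finite_atLeastLessThan_int)
  moreover have "arc \<beta> y \<and> (\<exists>c\<in>{0..<m}. dil (y - e c)) \<longleftrightarrow> (\<exists>j::int. 0 \<le> of_int y * \<theta> - of_int j \<and> of_int y * \<theta> - of_int j \<le> \<beta>)"
    for y
  proof
    assume "arc \<beta> y \<and> (\<exists>c\<in>{0..<m}. dil (y - e c))"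
    then obtain \<delta> c and j :: int where \<delta>: "\<delta> \<in> periods" "0 \<le> of_int y * \<theta> - \<delta>" "of_int y * \<theta> - \<delta> \<le> \<beta>"
      and j: "0 \<le> of_int (y - e c) * \<theta> - of_int j" "of_int (y - e c) * \<theta> - of_int j \<le> of_int m * \<beta>1"
      unfolding arc_def dil by blast
    obtain i :: int where i: "of_int m * \<delta> = of_int i" using \<delta>(1) per by blast
    define n where "n = j + f c"
    have d: "\<delta> - of_int n = (of_int (y - e c) * \<theta> - of_int j) + (of_int (e c) * \<theta> - of_int (f c)) - (of_int y * \<theta> - \<delta>)"
      by (simp add: n_def algebra_simps)
    have "\<delta> - of_int n < 1 / (2 * of_int m)" using e(3)[of c] j(2) \<delta>(2) m\<beta> unfolding d by linarith
    moreover have "- (1 / (2 * of_int m)) - 1 / (2 * of_int m) < \<delta> - of_int n"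
      using e(2)[of c] j(1) \<delta>(3) m\<beta> \<beta>1m \<beta> unfolding d by linarith
    moreover have "1 / (2 * of_int m) + 1 / (2 * of_int m) = 1 / real_of_int m" by simp
    moreover have "1 / (2 * of_int m) \<le> 1 / real_of_int m" using rm by (simp add: field_simps)
    \<comment> \<open>The distance from the period \<delta> to the integer n is less than 1/m while
      m \<delta> is an integer; this forces \<delta> = n.\<close>
    ultimately have "\<bar>\<delta> - of_int n\<bar> < 1 / of_int m" by linarith
    then have "of_int m * \<bar>\<delta> - of_int n\<bar> < 1" using rm by (simp add: field_simps)
    moreover have "of_int m * \<bar>\<delta> - of_int n\<bar> = \<bar>real_of_int (i - m * n)\<bar>"
      using rm i by (simp add: abs_mult_pos' right_diff_distrib)
    ultimately have "i = m * n" by linarith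
    then have "\<delta> = of_int n" using i rm by simp
    then show "\<exists>j::int. 0 \<le> of_int y * \<theta> - of_int j \<and> of_int y * \<theta> - of_int j \<le> \<beta>" using \<delta> by auto
  next
    assume "\<exists>j::int. 0 \<le> of_int y * \<theta> - of_int j \<and> of_int y * \<theta> - of_int j \<le> \<beta>"
    then obtain j :: int where j: "0 \<le> of_int y * \<theta> - of_int j" "of_int y * \<theta> - of_int j \<le> \<beta>" by blast
    define c where "c = y mod m"
    have "(y - e c) mod m = 0" using e(1)[of c] by (simp add: c_def mod_diff_eq[symmetric, of y])
    then have "m dvd y - e c" by (simp add: mod_eq_0_iff_dvd)
    moreover have eq: "of_int (y - e c) * \<theta> - of_int (j - f c) = (of_int y * \<theta> - of_int j) - (of_int (e c) * \<theta> - of_int (f c))"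
      by (simp add: algebra_simps)
    have "0 \<le> of_int (y - e c) * \<theta> - of_int (j - f c)" "of_int (y - e c) * \<theta> - of_int (j - f c) \<le> of_int m * \<beta>1"
      using e(2,3)[of c] j \<beta>1m unfolding eq by linarith+
    ultimately have "dil (y - e c)" unfolding dil by blast
    moreover have "c \<in> {0..<m}" using m by (simp add: c_def)
    moreover have "arc \<beta> y" unfolding arc_def using j periods_int by blast
    ultimately show "arc \<beta> y \<and> (\<exists>c\<in>{0..<m}. dil (y - e c))" by blast
  qed
  ultimately have "(\<lambda>w. \<exists>j::int. 0 \<le> of_int (w 0) * \<theta> - of_int j \<and> of_int (w 0) * \<theta> - of_int j \<le> of_int b * \<theta> - of_int k) \<in> dfn B"
    unfolding \<beta>_def[symmetric] by simp
  then show ?thesis using b \<beta> by (intro exI[of _ b] exI[of _ k]) (auto simp: \<beta>_def)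
qed

text \<open>Starting at -\<theta>, n closed arcs of length \<beta> are laid end to end, and one more
  ending at 0 covers the rest. The endpoints, which are the elements -1 and 0, are then
  removed.\<close>

theorem beatty_definable:
  assumes s: "(\<lambda>w. s (of_int (w 0) * \<theta>)) \<in> dfn B"
  shows "beatty_pred \<in> dfn B"
proof -
  define arc where "arc \<beta> x \<longleftrightarrow> (\<exists>j::int. 0 \<le> of_int x * \<theta> - of_int j \<and> of_int x * \<theta> - of_int j \<le> \<beta>)" for \<beta> :: real and x :: int
  obtain b k0 :: int where b: "0 < of_int b * \<theta> - of_int k0" "of_int b * \<theta> - of_int k0 < \<theta>"
    and arc0: "(\<lambda>w. arc (of_int b * \<theta> - of_int k0) (w 0)) \<in> dfn B"
    using arc_definable[OF s] unfolding arc_def by blast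
  define \<beta> where "\<beta> = of_int b * \<theta> - of_int k0"
  have \<beta>: "0 < \<beta>" "\<beta> < \<theta>" using b by (auto simp: \<beta>_def)
  define n where "n = \<lfloor>\<theta> / \<beta>\<rfloor>"
  have "of_int n \<le> \<theta> / \<beta>" by (simp add: n_def)
  then have n: "of_int n * \<beta> \<le> \<theta>" using \<beta> by (simp add: field_simps)
  have arc: "(\<lambda>w. arc \<beta> (g w)) \<in> dfn B" if "aff g" for g
    using dfn_subst_unary[OF arc0 that] by (simp add: \<beta>_def)
  have "(\<lambda>w. (\<not> w 0 = 0 \<and> \<not> w 0 = - 1) \<and> ((\<exists>i\<in>{0..<n}. arc \<beta> (w 0 + (1 - i * b))) \<or> arc \<beta> (w 0 + b))) \<in> dfn B"
    by (intro conj neg const dfn_disj dfn_Bex arc aff_add aff_var aff_const finite_atLeastLessThan_int)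
  moreover have "beatty_pred w \<longleftrightarrow>
     (\<not> w 0 = 0 \<and> \<not> w 0 = - 1) \<and> ((\<exists>i\<in>{0..<n}. arc \<beta> (w 0 + (1 - i * b))) \<or> arc \<beta> (w 0 + b))" for w
  proof
    assume "beatty_pred w"
    then obtain k :: int where k: "- \<theta> < of_int (w 0) * \<theta> - of_int k" "of_int (w 0) * \<theta> - of_int k < 0"
      unfolding beatty_pred_def P_set_iff by blast
    have "w 0 \<noteq> 0"
    proof
      assume "w 0 = 0"
      then have "real_of_int 0 < of_int k" "real_of_int k < of_int 1" using k theta by auto
      then show False unfolding of_int_less_iff by simp
    qed
    moreover have "w 0 \<noteq> - 1"
    proof
      assume "w 0 = - 1"
      then have "real_of_int (- 1) < of_int k" "real_of_int k < of_int 0" using k theta by auto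
      then show False unfolding of_int_less_iff by simp
    qed
    moreover have "(\<exists>i\<in>{0..<n}. arc \<beta> (w 0 + (1 - i * b))) \<or> arc \<beta> (w 0 + b)"
    proof (cases "- \<beta> \<le> of_int (w 0) * \<theta> - of_int k")
      case True
      then have "0 \<le> of_int (w 0 + b) * \<theta> - of_int (k + k0)" "of_int (w 0 + b) * \<theta> - of_int (k + k0) \<le> \<beta>"
        using k by (auto simp: \<beta>_def algebra_simps)
      then show ?thesis unfolding arc_def by blast
    next
      case False
      \<comment> \<open>The position in the arc, measured from -\<theta> in units of \<beta>; its
        integer part selects the tile.\<close>
      define u where "u = (of_int (w 0) * \<theta> - of_int k + \<theta>) / \<beta>"
      have u\<beta>: "u * \<beta> = of_int (w 0) * \<theta> - of_int k + \<theta>" using \<beta> by (simp add: u_def)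
      have "0 \<le> u" using k \<beta> by (simp add: u_def)
      moreover have "u * \<beta> + \<beta> < \<theta>" using False unfolding u\<beta> by linarith
      then have "u + 1 < \<theta> / \<beta>" using \<beta> by (simp add: pos_less_divide_eq algebra_simps)
      then have "\<lfloor>u\<rfloor> < n" unfolding n_def by linarith
      ultimately have i: "\<lfloor>u\<rfloor> \<in> {0..<n}" by simp
      have e: "of_int (w 0 + (1 - \<lfloor>u\<rfloor> * b)) * \<theta> - of_int (k - \<lfloor>u\<rfloor> * k0) = (u - of_int \<lfloor>u\<rfloor>) * \<beta>"
        unfolding left_diff_distrib u\<beta> by (simp add: \<beta>_def algebra_simps)
      have "0 \<le> (u - of_int \<lfloor>u\<rfloor>) * \<beta>" "(u - of_int \<lfloor>u\<rfloor>) * \<beta> \<le> 1 * \<beta>"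
        using \<beta> by (intro mult_nonneg_nonneg mult_right_mono; linarith)+
      then have "arc \<beta> (w 0 + (1 - \<lfloor>u\<rfloor> * b))"
        unfolding arc_def by (intro exI[of _ "k - \<lfloor>u\<rfloor> * k0"]) (simp only: e, simp)
      then show ?thesis using i by blast
    qed
    ultimately show "(\<not> w 0 = 0 \<and> \<not> w 0 = - 1) \<and> ((\<exists>i\<in>{0..<n}. arc \<beta> (w 0 + (1 - i * b))) \<or> arc \<beta> (w 0 + b))"
      by blast
  next
    assume R: "(\<not> w 0 = 0 \<and> \<not> w 0 = - 1) \<and> ((\<exists>i\<in>{0..<n}. arc \<beta> (w 0 + (1 - i * b))) \<or> arc \<beta> (w 0 + b))"
    have "\<exists>k::int. - \<theta> \<le> of_int (w 0) * \<theta> - of_int k \<and> of_int (w 0) * \<theta> - of_int k \<le> 0"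
      using R
    proof (elim conjE disjE bexE)
      assume "arc \<beta> (w 0 + b)"
      then obtain j :: int where "0 \<le> of_int (w 0 + b) * \<theta> - of_int j" "of_int (w 0 + b) * \<theta> - of_int j \<le> \<beta>"
        unfolding arc_def by blast
      then show ?thesis using \<beta> by (intro exI[of _ "j - k0"]) (auto simp: \<beta>_def algebra_simps)
    next
      fix i assume i: "i \<in> {0..<n}" "arc \<beta> (w 0 + (1 - i * b))"
      then obtain j :: int where j: "0 \<le> of_int (w 0 + (1 - i * b)) * \<theta> - of_int j"
         "of_int (w 0 + (1 - i * b)) * \<theta> - of_int j \<le> \<beta>"
        unfolding arc_def by blast
      have e: "of_int (w 0 + (1 - i * b)) * \<theta> - of_int j = of_int (w 0) * \<theta> - of_int (j + i * k0) + \<theta> - of_int i * \<beta>"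
        by (simp add: \<beta>_def algebra_simps)
      have "of_int (i + 1) * \<beta> \<le> of_int n * \<beta>" using i \<beta> by (intro mult_right_mono) auto
      then have "of_int i * \<beta> + \<beta> \<le> \<theta>" using n by (simp add: algebra_simps)
      moreover have "0 \<le> of_int i * \<beta>" using i \<beta> by simp
      ultimately show ?thesis using j unfolding e by (intro exI[of _ "j + i * k0"]) linarith
    qed
    then obtain k :: int where k: "- \<theta> \<le> of_int (w 0) * \<theta> - of_int k" "of_int (w 0) * \<theta> - of_int k \<le> 0" by blast
    have "of_int (w 0) * \<theta> - of_int k \<noteq> 0" using R int_theta_eq[of "w 0" k] by auto
    moreover have "of_int (w 0) * \<theta> - of_int k \<noteq> - \<theta>"
      using R int_theta_eq[of "w 0 + 1" k] by (auto simp: algebra_simps)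
    ultimately show "beatty_pred w" unfolding beatty_pred_def P_set_iff using k by (intro exI[of _ k]) auto
  qed
  ultimately show ?thesis by presburger
qed

end

section \<open>Reduction to one variable\<close>

lemma supported_ex:
  assumes "supported (Suc K) R"
  shows "supported K (\<lambda>w. \<exists>a. R (w(K := a)))"
  unfolding supported_def
proof (intro allI impI)
  fix w w' :: "nat \<Rightarrow> int" assume "\<forall>i<K. w i = w' i"
  then have "R (w(K := a)) = R (w'(K := a))" for a
    by (intro supportedD[OF assms]) (auto simp: less_Suc_eq)
  then show "(\<exists>a. R (w(K := a))) = (\<exists>a. R (w'(K := a)))" by simp
qed

context beatty
begin

lemma frac_theta_inj: "frac (\<theta> * of_int a) = frac (\<theta> * of_int b) \<Longrightarrow> a = b"
proof -
  assume "frac (\<theta> * of_int a) = frac (\<theta> * of_int b)"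
  then have "of_int (a - b) * \<theta> = of_int (\<lfloor>\<theta> * of_int a\<rfloor> - \<lfloor>\<theta> * of_int b\<rfloor>)"
    by (simp add: frac_def algebra_simps)
  from int_theta_eq[OF this] show "a = b" by simp
qed

text \<open>On the class of \<open>y1\<close> modulo \<open>N\<close>, the set \<open>Y\<close> is a finite union of arcs up to finitely many points,
  with respect to the rotation by \<open>\<theta> / N\<close>. Writing \<open>y = N * z + y1\<close> turns this into the rotation by \<open>\<theta>\<close>.\<close>

lemma nonconstant_definable:
  assumes Y: "(\<lambda>w. Y (w 0)) \<in> dfn B" and N: "N > 0" and E: "finite E"
    and inv: "\<And>y y'. y mod N = y' mod N \<Longrightarrow> \<lfloor>\<theta> * of_int y\<rfloor> mod N = \<lfloor>\<theta> * of_int y'\<rfloor> mod N \<Longrightarrow>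
       (\<And>e. e \<in> E \<Longrightarrow> sgn (frac (\<theta> * of_int y) - e) = sgn (frac (\<theta> * of_int y') - e)) \<Longrightarrow> Y y = Y y'"
    and y12: "y1 mod N = y2 mod N" "frac (\<theta> * of_int y1) \<notin> E" "frac (\<theta> * of_int y2) \<notin> E" "Y y1 \<noteq> Y y2"
  shows "beatty_pred \<in> dfn B"
proof -
  define c where "c = y1"
  define Z where "Z z = Y (N * z + c)" for z
  define good where "good z \<longleftrightarrow> frac (\<theta> * of_int (N * z + c)) \<notin> E" for z
  \<comment> \<open>\<open>brk e i\<close> is the point t with N t + c \<theta> = e + i. Modulo 1
    only i modulo N matters, and the additional 0 in \<open>E'\<close> records where the floor of N
    t + c \<theta> changes.\<close>
  define brk where "brk e i = (e + of_int i - of_int c * \<theta>) / of_int N" for e :: real and i :: int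
  define E' where "E' = (\<lambda>(e, i). brk e i) ` (insert 0 E \<times> {0..<N})"
  have rN: "real_of_int N > 0" using N by simp
  have finE': "finite E'" using E by (simp add: E'_def)
  have brk_E': "\<exists>e'\<in>E'. \<exists>k::int. brk e i = e' + of_int k" if "e \<in> insert 0 E" for e i
  proof -
    have "brk e (i mod N) \<in> E'" using that N unfolding E'_def by (intro rev_image_eqI[of "(e, i mod N)"]) auto
    moreover have "brk e i = brk e (i mod N) + of_int (i div N)"
    proof -
      have "real_of_int i = of_int (i div N) * of_int N + of_int (i mod N)"
        by (metis div_mult_mod_eq of_int_add of_int_mult)
      then show ?thesis using rN by (simp add: brk_def field_simps)
    qed
    ultimately show ?thesis by blast
  qed
  have same: "Z z = Z z'"
    if le: "of_int z * \<theta> - of_int k \<le> of_int z' * \<theta> - of_int k'" and good: "good z"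
      and nobrk: "\<And>e l::int. e \<in> E' \<Longrightarrow> \<not> (of_int z * \<theta> - of_int k < e + of_int l \<and> e + of_int l \<le> of_int z' * \<theta> - of_int k')"
    for z z' k k' :: int
  proof -
    define x x' where "x = of_int N * (of_int z * \<theta> - of_int k) + of_int c * \<theta>"
      and "x' = of_int N * (of_int z' * \<theta> - of_int k') + of_int c * \<theta>"
    have xx': "x \<le> x'" using le rN by (simp add: x_def x'_def)
    have nob: "\<not> (x < e + of_int i \<and> e + of_int i \<le> x')" if e: "e \<in> insert 0 E" for e and i :: int
    proof
      assume a: "x < e + of_int i \<and> e + of_int i \<le> x'"
      have "of_int N * brk e i = e + of_int i - of_int c * \<theta>" using rN by (simp add: brk_def)
      then have "of_int N * (of_int z * \<theta> - of_int k) < of_int N * brk e i"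
        "of_int N * brk e i \<le> of_int N * (of_int z' * \<theta> - of_int k')"
        using a by (auto simp: x_def x'_def)
      then have "of_int z * \<theta> - of_int k < brk e i" "brk e i \<le> of_int z' * \<theta> - of_int k'"
        using rN by simp_all
      then show False using brk_E'[OF e, of i] nobrk by auto
    qed
    have X: "\<theta> * of_int (N * z + c) = x + of_int (N * k)" "\<theta> * of_int (N * z' + c) = x' + of_int (N * k')"
      by (simp_all add: x_def x'_def algebra_simps)
    have "of_int \<lfloor>x'\<rfloor> \<le> x" using nob[of 0 "\<lfloor>x'\<rfloor>"] by (simp add: not_less)
    then have fl: "\<lfloor>x'\<rfloor> = \<lfloor>x\<rfloor>" using xx' by linarith
    have fx: "frac (x + of_int (N * k)) = x - of_int \<lfloor>x\<rfloor>" "frac (x' + of_int (N * k')) = x' - of_int \<lfloor>x\<rfloor>"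
      unfolding frac_def floor_add_int[symmetric] fl by simp_all
    have "Y (N * z + c) = Y (N * z' + c)"
    proof (rule inv)
      show "(N * z + c) mod N = (N * z' + c) mod N" by simp
      show "\<lfloor>\<theta> * of_int (N * z + c)\<rfloor> mod N = \<lfloor>\<theta> * of_int (N * z' + c)\<rfloor> mod N"
        unfolding X floor_add_int[symmetric] fl by simp
      show "sgn (frac (\<theta> * of_int (N * z + c)) - e) = sgn (frac (\<theta> * of_int (N * z' + c)) - e)" if e: "e \<in> E" for e
      proof -
        have "x - of_int \<lfloor>x\<rfloor> \<noteq> e" using good e unfolding good_def X fx by blast
        then show ?thesis unfolding X fx using nob[of e "\<lfloor>x\<rfloor>"] e xx' by (auto simp: sgn_if)
      qed
    qed
    then show ?thesis by (simp add: Z_def)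
  qed
  have fin_bad: "finite {z. \<not> good z}"
  proof -
    have "inj (\<lambda>z. frac (\<theta> * of_int (N * z + c)))"
      by (rule injI, drule frac_theta_inj) (use N in simp)
    from finite_vimageI[OF E this] show ?thesis by (simp add: vimage_def good_def)
  qed
  have goodI: "good z" if "\<And>e l. e \<in> E' \<Longrightarrow> e + of_int l \<noteq> of_int z * \<theta> - of_int k" for z k :: int
  proof (rule ccontr)
    assume "\<not> good z"
    define e where "e = frac (\<theta> * of_int (N * z + c))"
    have "brk e (\<lfloor>\<theta> * of_int (N * z + c)\<rfloor> - N * k) = of_int z * \<theta> - of_int k"
      using rN by (simp add: brk_def e_def frac_def field_simps)
    then show False using brk_E'[of e] that \<open>\<not> good z\<close> by (auto simp: good_def e_def) metis
  qed
  \<comment> \<open>Taking the value just to the right of t repairs the finitely many exceptional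
    points and gives a right-continuous function on the reals.\<close>
  define s where "s t \<longleftrightarrow> (\<exists>\<epsilon>>0. \<forall>z k::int. t < of_int z * \<theta> - of_int k \<and> of_int z * \<theta> - of_int k < t + \<epsilon> \<longrightarrow> Z z)" for t
  have s_eq: "s u = v"
    if Zv: "\<And>z k::int. a < of_int z * \<theta> - of_int k \<Longrightarrow> of_int z * \<theta> - of_int k < b \<Longrightarrow> Z z = v"
      and u: "a \<le> u" "u < b" for a b u v
  proof (cases v)
    case True
    then show ?thesis unfolding s_def using Zv u by (intro iffI TrueI exI[of _ "b - u"]) force+
  next
    case False
    have "\<not> s u"
    proof
      assume "s u"
      then obtain \<epsilon> where \<epsilon>: "\<epsilon> > 0" "\<And>z k::int. u < of_int z * \<theta> - of_int k \<Longrightarrow> of_int z * \<theta> - of_int k < u + \<epsilon> \<Longrightarrow> Z z"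
        unfolding s_def by blast
      obtain z k :: int where "u < of_int z * \<theta> - of_int k" "of_int z * \<theta> - of_int k < min b (u + \<epsilon>)"
        using rotation_dense[of u "min b (u + \<epsilon>)"] u \<epsilon>(1) by auto
      then show False using \<epsilon>(2)[of z k] Zv[of z k] u False by simp
    qed
    then show ?thesis using False by simp
  qed
  note gap = finite_mod_1_gap[OF finE']
  have s_Z: "s (of_int z * \<theta>) = Z z" if good: "good z" for z
  proof -
    obtain \<epsilon> where \<epsilon>: "\<epsilon> > 0" "\<And>e l. e \<in> E' \<Longrightarrow> \<not> (of_int z * \<theta> < e + of_int l \<and> e + of_int l < of_int z * \<theta> + \<epsilon>)"
      using gap by blast
    show ?thesis
    proof (rule s_eq[of "of_int z * \<theta>" "of_int z * \<theta> + \<epsilon>"])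
      show "Z z' = Z z" if "of_int z * \<theta> < of_int z' * \<theta> - of_int k'" "of_int z' * \<theta> - of_int k' < of_int z * \<theta> + \<epsilon>" for z' k'
        by (rule same[of z 0 z' k', symmetric, OF _ good]) (use that \<epsilon>(2) in force)+
    qed (use \<epsilon> in auto)
  qed
  have s_step: "s a = s b" if ab: "a \<le> b" and nobrk: "\<And>e k::int. e \<in> E' \<Longrightarrow> \<not> (a < e + of_int k \<and> e + of_int k \<le> b)" for a b
  proof -
    obtain \<epsilon> where \<epsilon>: "\<epsilon> > 0" "\<And>e l. e \<in> E' \<Longrightarrow> \<not> (b < e + of_int l \<and> e + of_int l < b + \<epsilon>)"
      using gap by blast
    have no: "\<not> (a < e + of_int l \<and> e + of_int l < b + \<epsilon>)" if "e \<in> E'" for e and l :: int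
      using nobrk[OF that] \<epsilon>(2)[OF that] by force
    obtain z0 k0 :: int where z0: "a < of_int z0 * \<theta> - of_int k0" "of_int z0 * \<theta> - of_int k0 < b + \<epsilon>"
      using rotation_dense[of a "b + \<epsilon>"] ab \<epsilon>(1) by auto
    have good: "good z" if "a < of_int z * \<theta> - of_int k" "of_int z * \<theta> - of_int k < b + \<epsilon>" for z k :: int
      by (rule goodI[of z k]) (metis no that)
    have *: "Z z = Z z0" if z: "a < of_int z * \<theta> - of_int k" "of_int z * \<theta> - of_int k < b + \<epsilon>" for z k :: int
    proof (cases "of_int z * \<theta> - of_int k \<le> of_int z0 * \<theta> - of_int k0")
      case True
      show ?thesis by (rule same[OF True good[OF z]]) (meson no z z0 less_trans le_less_trans)
    next
      case False
      then have "of_int z0 * \<theta> - of_int k0 \<le> of_int z * \<theta> - of_int k" by simp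
      then show ?thesis by (rule same[symmetric, OF _ good[OF z0]]) (meson no z z0 less_trans le_less_trans)
    qed
    have "s a = Z z0" "s b = Z z0"
      by (rule s_eq[of a "b + \<epsilon>", OF *]; use ab \<epsilon>(1) in simp)+
    then show ?thesis by simp
  qed
  have s_period: "s (x + 1) = s x" for x
  proof -
    define Q where "Q \<epsilon> z k \<longleftrightarrow> (x < of_int z * \<theta> - of_int k \<and> of_int z * \<theta> - of_int k < x + \<epsilon> \<longrightarrow> Z z)"
      for \<epsilon> and z k :: int
    have "s (x + 1) \<longleftrightarrow> (\<exists>\<epsilon>>0. \<forall>z k. Q \<epsilon> z (k + 1))"
      unfolding s_def Q_def by (simp add: algebra_simps)
    also have "\<dots> \<longleftrightarrow> (\<exists>\<epsilon>>0. \<forall>z k. Q \<epsilon> z k)"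
      by (metis diff_add_cancel)
    finally show ?thesis unfolding s_def Q_def .
  qed
  have "good 0" using y12(2) by (simp add: good_def c_def)
  obtain z2 where z2: "y2 = N * z2 + c"
    using y12(1) by (metis c_def div_mult_mod_eq add.commute mod_eq_dvd_iff dvd_def diff_eq_eq)
  have "good z2" using y12(3) by (simp add: good_def z2)
  then have "s (of_int 0 * \<theta>) \<noteq> s (of_int z2 * \<theta>)"
    unfolding s_Z[OF \<open>good 0\<close>] s_Z[OF \<open>good z2\<close>] using y12(4) by (simp add: Z_def z2) (simp add: c_def)
  then interpret step_fun r s E'
    by unfold_locales (use finE' s_period s_step in blast)+
  have Zd: "(\<lambda>w. Z (w 0)) \<in> dfn B"
    unfolding Z_def by (intro dfn_subst_unary[OF Y] aff_add aff_scale aff_var aff_const)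
  \<comment> \<open>On multiples of \<theta>, \<open>s\<close> and \<open>Z\<close> differ at most
    at the finitely many points that are not \<open>good\<close>, so \<open>s\<close> stays
    definable there.\<close>
  define bad where "bad = {z. \<not> good z \<and> s (of_int z * \<theta>)}"
  have s_iff: "s (of_int z * \<theta>) \<longleftrightarrow> ((\<not> (\<exists>b\<in>{z. \<not> good z}. z = b)) \<and> Z z) \<or> (\<exists>b\<in>bad. z = b)" for z
    using s_Z[of z] by (auto simp: bad_def)
  have "finite bad" using fin_bad by (rule finite_subset[rotated]) (auto simp: bad_def)
  then have "(\<lambda>w. s (of_int (w 0) * \<theta>)) \<in> dfn B"
    unfolding s_iff by (intro dfn_disj conj neg dfn_Bex const Zd fin_bad)
  then show ?thesis by (rule beatty_definable)
qed

section \<open>Zeros of real forms as equations, and the induction on variables\<close>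

text \<open>Both forms have the same linear part, and \<xi> differs from multiplication by \<theta>
  by integers; the unrelated constants cancel in the differences.\<close>

lemma lin_xi_diff:
  "lin f g \<Longrightarrow> \<exists>m::int. f (\<xi> w) - f (\<xi> w') = of_int (g w - g w') * \<theta> + of_int m"
proof (induction rule: lin.induct)
  case (lin_const c d)
  show ?case by (rule exI[of _ 0]) simp
next
  case (lin_var i)
  show ?case
    by (rule exI[of _ "\<lfloor>\<theta> * of_int (w' i)\<rfloor> - \<lfloor>\<theta> * of_int (w i)\<rfloor>"]) (simp add: \<xi>_def frac_def algebra_simps)
next
  case (lin_diff f g f' g')
  then obtain m m' :: int where "f (\<xi> w) - f (\<xi> w') = of_int (g w - g w') * \<theta> + of_int m"
    "f' (\<xi> w) - f' (\<xi> w') = of_int (g' w - g' w') * \<theta> + of_int m'" by blast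
  then show ?case by (intro exI[of _ "m - m'"]) (simp add: algebra_simps)
qed

text \<open>At two zeros of the real form the integer forms differ by some d with d \<theta> an
  integer, hence d = 0. This turns boundary points into linear equations in the group.\<close>

lemma lin_zero_int:
  assumes "lin f g"
  shows "\<exists>b. \<forall>w. f (\<xi> w) = 0 \<longrightarrow> g w = b"
proof (cases "\<exists>w. f (\<xi> w) = 0")
  case True
  then obtain w0 where w0: "f (\<xi> w0) = 0" by blast
  have "g w = g w0" if "f (\<xi> w) = 0" for w
  proof -
    obtain m :: int where "f (\<xi> w) - f (\<xi> w0) = of_int (g w - g w0) * \<theta> + of_int m"
      using lin_xi_diff[OF assms] by blast
    then have "of_int (g w - g w0) * \<theta> = of_int (- m)" using that w0 by simp
    from int_theta_eq[OF this] show ?thesis by simp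
  qed
  then show ?thesis by blast
qed simp

text \<open>The induction works because projections along the last variable stay in
  \<open>dfn B\<close>; tameness is obtained afresh at each stage from
  \<open>B \<subseteq> dfn {beatty_pred}\<close>.\<close>

theorem no_intermediate:
  assumes B: "B \<subseteq> dfn {beatty_pred}" and nb: "beatty_pred \<notin> dfn B"
  shows "R \<in> dfn B \<Longrightarrow> supported K R \<Longrightarrow> R \<in> dfn {}"
proof (induction K arbitrary: R)
  case 0
  then have "R = (\<lambda>w. R (\<lambda>_. 0))" by (auto simp: supported_def)
  then show ?case using dfn_triv by metis
next
  case (Suc K)
  have "R \<in> dfn {beatty_pred}" using dfn_cut[OF B] Suc.prems(1) by blast
  then obtain N F where tame: "tame_wrt N F R" using dfn_tame by blast
  then have N: "N > 0" and finF: "finite F" and linF: "\<And>q. q \<in> F \<Longrightarrow> lin (fst q) (snd q)"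
    by (auto simp: tame_wrt_def)
  have "\<exists>k f0 g0. (\<forall>x. fst q x = of_int k * x K + f0 x) \<and> (\<forall>w. snd q w = k * w K + g0 w)
     \<and> (\<forall>x a. f0 (x(K := a)) = f0 x) \<and> (\<forall>w a. g0 (w(K := a)) = g0 w)" if "q \<in> F" for q
    using lin_split[OF linF[OF that], of K] by blast
  then obtain k f0 g0 where split: "\<And>q x. q \<in> F \<Longrightarrow> fst q x = of_int (k q) * x K + f0 q x"
    "\<And>q w. q \<in> F \<Longrightarrow> snd q w = k q * w K + g0 q w"
    and indep: "\<And>q x a. q \<in> F \<Longrightarrow> f0 q (x(K := a)) = f0 q x" "\<And>q w a. q \<in> F \<Longrightarrow> g0 q (w(K := a)) = g0 q w"
    by metis
  have "\<exists>b. \<forall>w. fst q (\<xi> w) = 0 \<longrightarrow> snd q w = b" if "q \<in> F" for q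
    using lin_zero_int[OF linF[OF that]] .
  then obtain b where b: "\<And>q w. q \<in> F \<Longrightarrow> fst q (\<xi> w) = 0 \<Longrightarrow> snd q w = b q" by metis
  define F2 where "F2 = {q \<in> F. k q \<noteq> 0}"
  have finF2: "finite F2" using finF by (simp add: F2_def)
  \<comment> \<open>The forms in \<open>F\<close> may mention variables beyond those supporting
    \<open>R\<close>; setting these to 0 keeps the equations \<open>on q\<close> within the first K
    + 1 variables.\<close>
  define cut :: "(nat \<Rightarrow> int) \<Rightarrow> nat \<Rightarrow> int" where "cut w i = (if i < Suc K then w i else 0)" for w i
  have cut_upd: "cut (w(K := a)) = (cut w)(K := a)" for w a by (auto simp: cut_def)
  have cut_K: "cut w K = w K" for w by (simp add: cut_def)
  have R_cut: "R (cut w) = R w" for w by (rule supportedD[OF Suc.prems(2)]) (simp add: cut_def)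
  define on where "on q w \<longleftrightarrow> snd q (cut w) = b q" for q w
  have on_sup: "supported (Suc K) (on q)" for q
    unfolding supported_def
  proof (intro allI impI)
    fix w w' :: "nat \<Rightarrow> int" assume "\<forall>i<Suc K. w i = w' i"
    then have "cut w = cut w'" by (auto simp: cut_def)
    then show "on q w = on q w'" by (simp add: on_def)
  qed
  have on_dfn: "on q \<in> dfn C" if "q \<in> F" for q C
  proof -
    have "(\<lambda>w. snd q w = b q) \<in> dfn {}"
      using linF[OF that] by (intro dfn_eq aff_const) (auto simp: aff_def)
    moreover from this have "\<exists>L. supported L (\<lambda>w. snd q w = b q)" by (rule dfn_supported) simp
    then obtain L where "supported L (\<lambda>w. snd q w = b q)" ..
    moreover have "aff (\<lambda>w. cut w i)" for i
      by (cases "i < Suc K") (simp_all add: cut_def aff_var aff_const)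
    ultimately have "(\<lambda>w. snd q (\<lambda>i. cut w i) = b q) \<in> dfn {}" by (rule dfn_subst)
    then have "on q \<in> dfn {}" by (simp add: on_def[abs_def])
    then show ?thesis using dfn_cut[of "{}" C] by blast
  qed
  \<comment> \<open>A fibre violating this would satisfy the hypotheses of
    \<open>nonconstant_definable\<close>.\<close>
  have fibre: "R (w(K := y1)) = R (w(K := y2))"
    if y: "y1 mod N = y2 mod N" "\<And>q. q \<in> F2 \<Longrightarrow> \<not> on q (w(K := y1))" "\<And>q. q \<in> F2 \<Longrightarrow> \<not> on q (w(K := y2))"
    for w y1 y2
  proof (rule ccontr)
    assume ne: "R (w(K := y1)) \<noteq> R (w(K := y2))"
    define u where "u = cut w"
    have Ru: "R (w(K := a)) = R (u(K := a))" for a using R_cut[of "w(K := a)"] by (simp add: cut_upd u_def)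
    define Y where "Y a = R (u(K := a))" for a
    \<comment> \<open>The zeros of the forms in the last variable. Points off the equations
      \<open>on q\<close> avoid them, because a zero of the real form gives the integer form the
      value \<open>b q\<close>.\<close>
    define E where "E = (\<lambda>q. - f0 q (\<xi> u) / of_int (k q)) ` F2"
    have val: "fst q (\<xi> (u(K := a))) = of_int (k q) * frac (\<theta> * of_int a) + f0 q (\<xi> u)" if "q \<in> F" for q a
      using split(1)[OF that] indep(1)[OF that] by (simp add: xi_update)
    have "(\<lambda>w. R (\<lambda>i. if i = K then w 0 else u i)) \<in> dfn B"
    proof (rule dfn_subst[OF Suc.prems])
      show "aff (\<lambda>w. if i = K then w 0 else u i)" for i
        by (cases "i = K") (simp_all add: aff_var aff_const)
    qed
    moreover have "(\<lambda>i. if i = K then a else u i) = u(K := a)" for a by auto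
    ultimately have Ydfn: "(\<lambda>w. Y (w 0)) \<in> dfn B" by (simp add: Y_def)
    have notE: "frac (\<theta> * of_int a) \<notin> E" if a: "\<And>q. q \<in> F2 \<Longrightarrow> \<not> on q (w(K := a))" for a
    proof
      assume "frac (\<theta> * of_int a) \<in> E"
      then obtain q where q: "q \<in> F2" "frac (\<theta> * of_int a) = - f0 q (\<xi> u) / of_int (k q)" by (auto simp: E_def)
      then have "q \<in> F" "k q \<noteq> 0" by (auto simp: F2_def)
      then have "fst q (\<xi> (u(K := a))) = 0" using val[of q a] q(2) by simp
      then have "snd q (u(K := a)) = b q" using b \<open>q \<in> F\<close> by blast
      then show False using a[OF q(1)] by (simp add: on_def cut_upd u_def)
    qed
    have "beatty_pred \<in> dfn B"
    proof (rule nonconstant_definable[OF Ydfn N, where E = E])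
      show "finite E" using finF2 by (simp add: E_def)
      show "y1 mod N = y2 mod N" by (rule y)
      show "frac (\<theta> * of_int y1) \<notin> E" "frac (\<theta> * of_int y2) \<notin> E" using notE y by blast+
      show "Y y1 \<noteq> Y y2" using ne by (simp add: Y_def Ru)
      show "Y a = Y a'" if a: "a mod N = a' mod N" "\<lfloor>\<theta> * of_int a\<rfloor> mod N = \<lfloor>\<theta> * of_int a'\<rfloor> mod N"
         "\<And>e. e \<in> E \<Longrightarrow> sgn (frac (\<theta> * of_int a) - e) = sgn (frac (\<theta> * of_int a') - e)" for a a'
      proof -
        have "sim N F (u(K := a)) (u(K := a'))"
          unfolding sim_def
        proof (intro conjI allI)
          fix i
          obtain x where x: "a' = a + N * x" using a(1) by (metis mod_eqE)
          obtain x' where x': "\<lfloor>\<theta> * of_int a'\<rfloor> = \<lfloor>\<theta> * of_int a\<rfloor> + N * x'" using a(2) by (metis mod_eqE)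
          have "real_of_int a' = of_int a + of_int N * of_int x"
            "real_of_int \<lfloor>\<theta> * of_int a'\<rfloor> = of_int \<lfloor>\<theta> * of_int a\<rfloor> + of_int N * of_int x'"
            unfolding x' by (simp_all add: x)
          then have "frac (\<theta> * of_int a') = frac (\<theta> * of_int a) + of_int N * (of_int x * \<theta> - of_int x')"
            unfolding frac_floor by (simp add: algebra_simps)
          then have "cong_lat N (frac (\<theta> * of_int a)) (frac (\<theta> * of_int a'))" by (rule cong_latI)
          then show "cong_lat N (\<xi> (u(K := a)) i) (\<xi> (u(K := a')) i)"
            by (simp add: xi_update cong_lat_refl)
        next
          have "sgn (fst q (\<xi> (u(K := a)))) = sgn (fst q (\<xi> (u(K := a'))))" if q: "q \<in> F" for q
          proof (cases "k q = 0")
            case True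
            then show ?thesis by (simp only: val[OF q]) simp
          next
            case False
            define e where "e = - f0 q (\<xi> u) / of_int (k q)"
            have "e \<in> E" using q False by (auto simp: E_def e_def F2_def)
            have "of_int (k q) * t + f0 q (\<xi> u) = of_int (k q) * (t - e)" for t
              using False by (simp add: e_def field_simps)
            then show ?thesis by (simp only: val[OF q] sgn_mult a(3)[OF \<open>e \<in> E\<close>])
          qed
          then show "\<forall>(f, g)\<in>F. sgn (f (\<xi> (u(K := a)))) = sgn (f (\<xi> (u(K := a'))))" by force
        qed
        then show ?thesis using tame unfolding tame_wrt_def Y_def by blast
      qed
    qed
    then show False using nb by blast
  qed
  \<comment> \<open>Where \<open>on q\<close> holds, the nonzero coefficient at K determines the
    last coordinate; off all these equations only its class modulo N matters. In both cases
    \<open>R\<close> is recovered from a projection.\<close>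
  define Ron where "Ron q = (\<lambda>w. on q w \<and> R w)" for q
  define Roff where "Roff c = (\<lambda>w. w K mod N = c mod N \<and> \<not> (\<exists>q\<in>F2. on q w) \<and> R w)" for c
  have Ron: "(\<lambda>w. \<exists>a. Ron q (w(K := a))) \<in> dfn {}" if "q \<in> F2" for q
  proof (rule Suc.IH)
    have "Ron q \<in> dfn B" unfolding Ron_def using that by (intro conj on_dfn Suc.prems) (simp add: F2_def)
    then show "(\<lambda>w. \<exists>a. Ron q (w(K := a))) \<in> dfn B" by (rule ex)
    have "supported (Suc K) (Ron q)"
      using on_sup[of q] Suc.prems(2) unfolding supported_def Ron_def by blast
    then show "supported K (\<lambda>w. \<exists>a. Ron q (w(K := a)))" by (rule supported_ex)
  qed
  have Roff: "(\<lambda>w. \<exists>a. Roff c (w(K := a))) \<in> dfn {}" for c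
  proof (rule Suc.IH)
    have "Roff c \<in> dfn B" unfolding Roff_def
      by (intro conj dfn_cong_mod aff_var neg dfn_Bex finF2 on_dfn Suc.prems) (simp add: F2_def)
    then show "(\<lambda>w. \<exists>a. Roff c (w(K := a))) \<in> dfn B" by (rule ex)
    have "Roff c w = Roff c w'" if "\<forall>i<Suc K. w i = w' i" for w w'
      using on_sup Suc.prems(2) that unfolding supported_def Roff_def by (metis lessI)
    then show "supported K (\<lambda>w. \<exists>a. Roff c (w(K := a)))"
      by (intro supported_ex) (simp add: supported_def)
  qed
  have R_iff: "R w \<longleftrightarrow> (\<exists>q\<in>F2. on q w \<and> (\<exists>a. Ron q (w(K := a)))) \<or>
      (\<not> (\<exists>q\<in>F2. on q w) \<and> (\<exists>c\<in>{0..<N}. w K mod N = c mod N \<and> (\<exists>a. Roff c (w(K := a)))))" (is "_ \<longleftrightarrow> ?A \<or> ?C") for w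
  proof
    assume R: "R w"
    show "?A \<or> ?C"
    proof (cases "\<exists>q\<in>F2. on q w")
      case True
      then obtain q where "q \<in> F2" "on q w" by blast
      moreover from this have "Ron q (w(K := w K))" using R by (simp add: Ron_def)
      ultimately show ?thesis by blast
    next
      case False
      then have "Roff (w K mod N) (w(K := w K))" using R by (simp add: Roff_def)
      moreover have "w K mod N \<in> {0..<N}" using N by simp
      moreover have "w K mod N = (w K mod N) mod N" by simp
      ultimately show ?thesis using False by blast
    qed
  next
    assume "?A \<or> ?C"
    then show "R w"
    proof
      assume ?A
      then obtain q a where q: "q \<in> F2" "on q w" "on q (w(K := a))" "R (w(K := a))" by (auto simp: Ron_def)
      then have qF: "q \<in> F" "k q \<noteq> 0" by (auto simp: F2_def)
      have "k q * a + g0 q (cut w) = k q * w K + g0 q (cut w)"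
        using q(2,3) split(2)[OF qF(1)] indep(2)[OF qF(1)] by (simp add: on_def cut_upd cut_K)
      then have "a = w K" using qF(2) by simp
      then show "R w" using q(4) by simp
    next
      assume ?C
      then obtain c a where c: "\<not> (\<exists>q\<in>F2. on q w)" "w K mod N = c mod N" "Roff c (w(K := a))" by blast
      have "R (w(K := w K)) = R (w(K := a))"
        by (rule fibre) (use c in \<open>auto simp: Roff_def\<close>)
      then show "R w" using c(3) by (simp add: Roff_def)
    qed
  qed
  have "(\<lambda>w. R w) \<in> dfn {}"
    unfolding R_iff
    by (intro dfn_disj conj neg dfn_Bex finF2 finite_atLeastLessThan_int Ron Roff dfn_cong_mod aff_var on_dfn)
      (auto simp: F2_def)
  then show ?case .
qed

lemma reducts: "reduct (Gam_struct r)" "reduct (Gam_X_struct r n X)" "reduct (G_struct r)"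
  by (auto simp: reduct_def Gam_struct_def Gam_X_struct_def G_struct_def split: if_splits)

lemma rel_preds_simps:
  "rel_preds (Gam_struct r) = {}"
  "rel_preds (Gam_X_struct r n X) = {tuple_pred n X}"
  "rel_preds (G_struct r) = {beatty_pred}"
  by (auto simp: rel_preds_def Gam_struct_def Gam_X_struct_def G_struct_def tuple_pred_def[abs_def]
      beatty_pred_def[abs_def] split: if_splits)

end

theorem theorem6p7:
  fixes r :: real and n :: nat and X :: "complex list set"
  assumes "r > 1" and "r \<notin> \<rat>"
    and "n \<ge> 1" and "X \<subseteq> tuples n (Gam r)"
    and "definable (G_struct r) n X"
    and "\<not> definable (Gam_struct r) n X"
  shows "interdefinable (Gam_X_struct r n X) (G_struct r)"
proof -
  interpret beatty r using assms(1,2) by unfold_locales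
  have X: "tuple_pred n X \<in> dfn {beatty_pred}" "tuple_pred n X \<notin> dfn {}"
    using assms(4-6) by (simp_all add: definable_iff_dfn reducts rel_preds_simps)
  have sup: "supported n (tuple_pred n X)"
    unfolding supported_def by (intro allI impI tuple_pred_cong) simp
  \<comment> \<open>Otherwise \<open>no_intermediate\<close> would make X definable in the group
    alone.\<close>
  have "beatty_pred \<in> dfn {tuple_pred n X}"
    using no_intermediate[of "{tuple_pred n X}", OF _ _ dfn.base sup] X by blast
  then have "dfn {tuple_pred n X} = dfn {beatty_pred}"
    using X(1) dfn_cut[of "{tuple_pred n X}"] dfn_cut[of "{beatty_pred}"] by blast
  then have "definable (Gam_X_struct r n X) m Z = definable (G_struct r) m Z" for m Z
    by (simp add: definable_iff_dfn reducts rel_preds_simps)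
  moreover have "univ (Gam_X_struct r n X) = univ (G_struct r)"
    by (simp add: Gam_X_struct_def G_struct_def)
  ultimately show ?thesis unfolding interdefinable_def by blast
qed

end
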